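(* Let $G=\mathbf{CK}+\mathcal{C}$, where $\mathcal{C}$ is a finite set of constructive formulas. There is a polynomial-time algorithm that reads a $G$-proof $\pi$ of a sequent $\Omega\Rightarrow\Lambda$ (of $\mathcal{L}$-formulas) and outputs a finite multiset $\Sigma_\pi$ of $\mathcal{L}^+$-formulas and a $G$-proof $\sigma_\pi$ such that: (1) $G\vdash\Sigma_\pi,\Omega^t\Rightarrow\Lambda^t$; (2) every formula in $\Sigma_\pi$ is a modal Horn formula constructed from angled atoms (i.e. all atoms occurring in it are angled atoms); (3) $\sigma_\pi$ is a $G$-proof of $\Rightarrow\bigwedge\Sigma_\pi^{s}$, where $s$ is the standard substitution.
   Context: Formulas of $\mathcal{L}$ are built from atoms, $\top,\bot$ by $\wedge,\vee,\to,\Box,\Diamond$; $\neg A:=A\to\bot$; $\Diamond^0A=A$, $\Diamond^{n+1}A=\Diamond\Diamond^nA$; $\bigwedge\varnothing=\top$. Sequents $\Sigma\Rightarrow\Lambda$ have finite multisets on both sides. A rule is given by meta-sequents (premises and conclusion) built from formulas with schematic atoms and multiset variables; instances substitute formulas for atoms and multisets for variables; axioms are rules without premises. A calculus is a finite set of rules; $G+\mathcal{C}$ adds the axioms $(\Rightarrow C)$, $C\in\mathcal{C}$. A $G$-proof is a tree-like sequence of sequents each an axiom instance or obtained from earlier ones by a rule instance; rules of $G$ may also be instantiated with $\mathcal{L}^+$-formulas. Polynomial time is measured in the number of symbols of the input. $\mathbf{LJ}$: single-conclusion calculus ($\Delta$ at most one formula) with $\Gamma,p\Rightarrow p$; $\Gamma,\bot\Rightarrow\Delta$;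 $\Gamma\Rightarrow\top$; left/right weakening; left contraction; cut $\frac{\Gamma\Rightarrow p\ \ \Gamma,p\Rightarrow\Delta}{\Gamma\Rightarrow\Delta}$; $\frac{\Gamma,p\Rightarrow\Delta}{\Gamma,p\wedge q\Rightarrow\Delta}$, $\frac{\Gamma,q\Rightarrow\Delta}{\Gamma,p\wedge q\Rightarrow\Delta}$, $\frac{\Gamma\Rightarrow p\ \ \Gamma\Rightarrow q}{\Gamma\Rightarrow p\wedge q}$, $\frac{\Gamma,p\Rightarrow\Delta\ \ \Gamma,q\Rightarrow\Delta}{\Gamma,p\vee q\Rightarrow\Delta}$, $\frac{\Gamma\Rightarrow p}{\Gamma\Rightarrow p\vee q}$, $\frac{\Gamma\Rightarrow q}{\Gamma\Rightarrow p\vee q}$, $\frac{\Gamma\Rightarrow p\ \ \Gamma,q\Rightarrow\Delta}{\Gamma,p\to q\Rightarrow\Delta}$, $\frac{\Gamma,p\Rightarrow q}{\Gamma\Rightarrow p\to q}$. $\mathbf{CK}=\mathbf{LJ}+\{(K_\Box)\ \frac{\Gamma\Rightarrow p}{\Box\Gamma\Rightarrow\Box p},\ (K_\Diamond)\ \frac{\Gamma,p\Rightarrow q}{\Box\Gamma,\Diamond p\Rightarrow\Diamond q}\}$. Constructive formulas: basic formulas are the smallest set containing atoms, $\top,\bot$ closed under $\wedge,\vee,\Diamond$; almost positive formulas are the smallest set containing basic formulas closed under $\wedge,\vee,\Box,\Diamond$ and $A\to B$ with $A$ basic and $B$ almost positive; constructive formulas are the smallest set containing basic formulas closed under $\wedge,\Box$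 and $A\to B$ with $A$ almost positive and $B$ constructive. $\mathcal{L}^+$: for each $\mathcal{L}$-formula $\varphi$ add a fresh atom $\langle\varphi\rangle$ (an angled atom); atoms of $\mathcal{L}^+$ are the atoms of $\mathcal{L}$ and the angled atoms. Translation $t:\mathcal{L}\to\mathcal{L}^+$: $\bot^t=\bot$, $\top^t=\langle\top\rangle$, $p^t=\langle p\rangle$ for atoms $p$; $(A\circ B)^t=(A^t\circ B^t)\wedge\langle A\circ B\rangle$ for $\circ\in\{\wedge,\vee,\to\}$; $(\bigcirc A)^t=(\bigcirc A^t)\wedge\langle\bigcirc A\rangle$ for $\bigcirc\in\{\Box,\Diamond\}$; $\Gamma^t=\{\gamma^t:\gamma\in\Gamma\}$. Standard substitution $s:\mathcal{L}^+\to\mathcal{L}$: $\langle\varphi\rangle^s=\varphi$, fixes atoms of $\mathcal{L}$ and $\top,\bot$, commutes with all connectives and modalities; $\Gamma^s=\{\gamma^s\}$. Modal Horn formulas: the smallest set of $\mathcal{L}^+$-formulas containing $\bot$ and all atoms of $\mathcal{L}^+$, closed under $\Box$ and under forming $A\to B$ where $A=\bigwedge_{i=1}^k\Diamond^{n_i}p_i$ for some $k\ge1$, $n_i\ge0$, atoms $p_i$, and $B$ is modal Horn. *)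

theory Defs
  imports "HOL-Library.Multiset" "HOL-Computational_Algebra.Polynomial"
begin

section \<open>Formulas\<close>

datatype (atoms: 'a) fm =
    Atom 'a
  | Top
  | Bot
  | And "'a fm" "'a fm"
  | Or "'a fm" "'a fm"
  | Imp "'a fm" "'a fm"
  | Box "'a fm"
  | Dia "'a fm"

text \<open>
  Formulas of the language L are of type \<^typ>\<open>nat fm\<close>: there are countably many atoms.
  The atoms of the extended language are those of L together with one angled atom
  for every formula of L.
\<close>

datatype plus_atom = Base nat | Angled "nat fm"

type_synonym form = "nat fm"
type_synonym form_plus = "plus_atom fm"

primrec fm_subst :: "('a \<Rightarrow> 'b fm) \<Rightarrow> 'a fm \<Rightarrow> 'b fm" where
  "fm_subst f (Atom a) = f a"
| "fm_subst f Top = Top"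
| "fm_subst f Bot = Bot"
| "fm_subst f (And A B) = And (fm_subst f A) (fm_subst f B)"
| "fm_subst f (Or A B) = Or (fm_subst f A) (fm_subst f B)"
| "fm_subst f (Imp A B) = Imp (fm_subst f A) (fm_subst f B)"
| "fm_subst f (Box A) = Box (fm_subst f A)"
| "fm_subst f (Dia A) = Dia (fm_subst f A)"

definition std_subst :: "form_plus \<Rightarrow> form" where
  "std_subst = fm_subst (\<lambda>a. case a of Base p \<Rightarrow> Atom p | Angled A \<Rightarrow> A)"

primrec translate :: "form \<Rightarrow> form_plus" where
  "translate (Atom p) = Atom (Angled (Atom p))"
| "translate Top = Atom (Angled Top)"
| "translate Bot = Bot"
| "translate (And A B) = And (And (translate A) (translate B)) (Atom (Angled (And A B)))"
| "translate (Or A B) = And (Or (translate A) (translate B)) (Atom (Angled (Or A B)))"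
| "translate (Imp A B) = And (Imp (translate A) (translate B)) (Atom (Angled (Imp A B)))"
| "translate (Box A) = And (Box (translate A)) (Atom (Angled (Box A)))"
| "translate (Dia A) = And (Dia (translate A)) (Atom (Angled (Dia A)))"

text \<open>Iterated conjunctions associate to the right and have no trailing \<^term>\<open>Top\<close>.\<close>

fun big_and :: "'a fm list \<Rightarrow> 'a fm" where
  "big_and [] = Top"
| "big_and [A] = A"
| "big_and (A # B # As) = And A (big_and (B # As))"

text \<open>
  A finite multiset of formulas has one conjunction for every way of listing its elements.
\<close>

definition is_conjunction_of :: "'a fm \<Rightarrow> 'a fm multiset \<Rightarrow> bool" where
  "is_conjunction_of A M \<longleftrightarrow> (\<exists>As. mset As = M \<and> A = big_and As)"

inductive basic :: "'a fm \<Rightarrow> bool" where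
  "basic (Atom p)"
| "basic Top"
| "basic Bot"
| "basic A \<Longrightarrow> basic B \<Longrightarrow> basic (And A B)"
| "basic A \<Longrightarrow> basic B \<Longrightarrow> basic (Or A B)"
| "basic A \<Longrightarrow> basic (Dia A)"

inductive almost_positive :: "'a fm \<Rightarrow> bool" where
  "basic A \<Longrightarrow> almost_positive A"
| "almost_positive A \<Longrightarrow> almost_positive B \<Longrightarrow> almost_positive (And A B)"
| "almost_positive A \<Longrightarrow> almost_positive B \<Longrightarrow> almost_positive (Or A B)"
| "almost_positive A \<Longrightarrow> almost_positive (Box A)"
| "almost_positive A \<Longrightarrow> almost_positive (Dia A)"
| "basic A \<Longrightarrow> almost_positive B \<Longrightarrow> almost_positive (Imp A B)"

inductive constructive :: "'a fm \<Rightarrow> bool" where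
  "basic A \<Longrightarrow> constructive A"
| "constructive A \<Longrightarrow> constructive B \<Longrightarrow> constructive (And A B)"
| "constructive A \<Longrightarrow> constructive (Box A)"
| "almost_positive A \<Longrightarrow> constructive B \<Longrightarrow> constructive (Imp A B)"

inductive modal_horn :: "form_plus \<Rightarrow> bool" where
  "modal_horn Bot"
| "modal_horn (Atom p)"
| "modal_horn A \<Longrightarrow> modal_horn (Box A)"
| "nps \<noteq> [] \<Longrightarrow> modal_horn B \<Longrightarrow>
     modal_horn (Imp (big_and (map (\<lambda>(n, p). (Dia ^^ n) (Atom p)) nps)) B)"


section \<open>Calculi and proofs\<close>

type_synonym 'a sequent = "'a fm multiset \<times> 'a fm multiset"

text \<open>
  A calculus is given by its rule instances: the list of premises, in the order in which the
  rule displays them, and the conclusion. The atom type is left open, so that the same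
  calculus can be used both for L and for the extended language.
\<close>

inductive LJ :: "'a sequent list \<Rightarrow> 'a sequent \<Rightarrow> bool" where
  Ax: "LJ [] (add_mset A \<Gamma>, {#A#})"
| BotL: "size \<Delta> \<le> 1 \<Longrightarrow> LJ [] (add_mset Bot \<Gamma>, \<Delta>)"
| TopR: "LJ [] (\<Gamma>, {#Top#})"
| WkL: "size \<Delta> \<le> 1 \<Longrightarrow> LJ [(\<Gamma>, \<Delta>)] (add_mset A \<Gamma>, \<Delta>)"
| WkR: "LJ [(\<Gamma>, {#})] (\<Gamma>, {#A#})"
| ConL: "size \<Delta> \<le> 1 \<Longrightarrow> LJ [(add_mset A (add_mset A \<Gamma>), \<Delta>)] (add_mset A \<Gamma>, \<Delta>)"
| Cut: "size \<Delta> \<le> 1 \<Longrightarrow> LJ [(\<Gamma>, {#A#}), (add_mset A \<Gamma>, \<Delta>)] (\<Gamma>, \<Delta>)"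
| AndL1: "size \<Delta> \<le> 1 \<Longrightarrow> LJ [(add_mset A \<Gamma>, \<Delta>)] (add_mset (And A B) \<Gamma>, \<Delta>)"
| AndL2: "size \<Delta> \<le> 1 \<Longrightarrow> LJ [(add_mset B \<Gamma>, \<Delta>)] (add_mset (And A B) \<Gamma>, \<Delta>)"
| AndR: "LJ [(\<Gamma>, {#A#}), (\<Gamma>, {#B#})] (\<Gamma>, {#And A B#})"
| OrL: "size \<Delta> \<le> 1 \<Longrightarrow>
    LJ [(add_mset A \<Gamma>, \<Delta>), (add_mset B \<Gamma>, \<Delta>)] (add_mset (Or A B) \<Gamma>, \<Delta>)"
| OrR1: "LJ [(\<Gamma>, {#A#})] (\<Gamma>, {#Or A B#})"
| OrR2: "LJ [(\<Gamma>, {#B#})] (\<Gamma>, {#Or A B#})"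
| ImpL: "size \<Delta> \<le> 1 \<Longrightarrow>
    LJ [(\<Gamma>, {#A#}), (add_mset B \<Gamma>, \<Delta>)] (add_mset (Imp A B) \<Gamma>, \<Delta>)"
| ImpR: "LJ [(add_mset A \<Gamma>, {#B#})] (\<Gamma>, {#Imp A B#})"

inductive CK :: "'a sequent list \<Rightarrow> 'a sequent \<Rightarrow> bool" where
  LJ_rule: "LJ Ps S \<Longrightarrow> CK Ps S"
| K_Box: "CK [(\<Gamma>, {#A#})] (image_mset Box \<Gamma>, {#Box A#})"
| K_Dia: "CK [(add_mset A \<Gamma>, {#B#})] (add_mset (Dia A) (image_mset Box \<Gamma>), {#Dia B#})"

text \<open>The atoms of the formulas in \<open>C\<close> are schematic in the added axioms.\<close>

inductive CK_plus :: "form set \<Rightarrow> 'a sequent list \<Rightarrow> 'a sequent \<Rightarrow> bool"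
  for C :: "form set" where
  CK_rule: "CK Ps S \<Longrightarrow> CK_plus C Ps S"
| Axiom: "A \<in> C \<Longrightarrow> CK_plus C [] ({#}, {#fm_subst f A#})"

text \<open>Tree-like proofs are trees of sequents, without rule annotations.\<close>

datatype 'a proof_tree = Proof_Tree (concl: "'a sequent") "'a proof_tree list"

fun is_proof :: "form set \<Rightarrow> 'a proof_tree \<Rightarrow> bool" where
  "is_proof C (Proof_Tree S \<pi>s) \<longleftrightarrow>
     CK_plus C (map concl \<pi>s) S \<and> (\<forall>\<pi> \<in> set \<pi>s. is_proof C \<pi>)"

definition proof_of :: "form set \<Rightarrow> 'a proof_tree \<Rightarrow> 'a sequent \<Rightarrow> bool" where
  "proof_of C \<pi> S \<longleftrightarrow> is_proof C \<pi> \<and> concl \<pi> = S"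

definition derivable :: "form set \<Rightarrow> 'a sequent \<Rightarrow> bool" where
  "derivable C S \<longleftrightarrow> (\<exists>\<pi>. proof_of C \<pi> S)"


section \<open>Algorithms and their running time\<close>

text \<open>
  Algorithms are first-order functional programs with general recursion, operating on
  binary trees (pure Lisp). A program is a list of function bodies; the variables of a
  body refer to the arguments of the call by position. Values other than \<^term>\<open>Leaf\<close>
  count as true, and head and tail of \<^term>\<open>Leaf\<close> are \<^term>\<open>Leaf\<close>.
\<close>

datatype data = Leaf | Fork data data

text \<open>The number of symbols of a tree in prefix notation.\<close>

primrec dsize :: "data \<Rightarrow> nat" where
  "dsize Leaf = 1"
| "dsize (Fork a b) = 1 + dsize a + dsize b"

primrec head :: "data \<Rightarrow> data" where
  "head Leaf = Leaf"
| "head (Fork a b) = a"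

primrec tail :: "data \<Rightarrow> data" where
  "tail Leaf = Leaf"
| "tail (Fork a b) = b"

definition truth :: "bool \<Rightarrow> data" where
  "truth b = (if b then Fork Leaf Leaf else Leaf)"

datatype exp =
    Var_Exp nat
  | Quote_Exp data
  | Cons_Exp exp exp
  | Hd_Exp exp
  | Tl_Exp exp
  | Eq_Exp exp exp
  | If_Exp exp exp exp
  | Call_Exp nat "exp list"

type_synonym program = "exp list"

text \<open>
  \<open>evaluates P \<rho> e v c\<close>: in environment \<open>\<rho>\<close> the expression \<open>e\<close> evaluates to \<open>v\<close> at cost \<open>c\<close>.
  Every evaluation step is charged one unit plus the size of the value it produces.
  Charging the size is essential: with unit cost, sharing would allow trees of
  exponential size to be built in linear time. With this measure a run of cost \<open>c\<close> can be
  carried out by a Turing machine in time polynomial in \<open>c\<close> and the size of the input, and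
  conversely a Turing machine can be simulated with polynomial overhead.
\<close>

inductive evaluates :: "program \<Rightarrow> data list \<Rightarrow> exp \<Rightarrow> data \<Rightarrow> nat \<Rightarrow> bool"
  and evaluates_list :: "program \<Rightarrow> data list \<Rightarrow> exp list \<Rightarrow> data list \<Rightarrow> nat \<Rightarrow> bool"
  for P :: program where
  Var: "i < length \<rho> \<Longrightarrow> evaluates P \<rho> (Var_Exp i) (\<rho> ! i) (1 + dsize (\<rho> ! i))"
| Quote: "evaluates P \<rho> (Quote_Exp v) v (1 + dsize v)"
| Cons: "evaluates P \<rho> e1 v1 c1 \<Longrightarrow> evaluates P \<rho> e2 v2 c2 \<Longrightarrow>
    evaluates P \<rho> (Cons_Exp e1 e2) (Fork v1 v2) (c1 + c2 + 1 + dsize (Fork v1 v2))"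
| Hd: "evaluates P \<rho> e v c \<Longrightarrow> evaluates P \<rho> (Hd_Exp e) (head v) (c + 1 + dsize (head v))"
| Tl: "evaluates P \<rho> e v c \<Longrightarrow> evaluates P \<rho> (Tl_Exp e) (tail v) (c + 1 + dsize (tail v))"
| Eq: "evaluates P \<rho> e1 v1 c1 \<Longrightarrow> evaluates P \<rho> e2 v2 c2 \<Longrightarrow>
    evaluates P \<rho> (Eq_Exp e1 e2) (truth (v1 = v2)) (c1 + c2 + 1 + dsize (truth (v1 = v2)))"
| If_true: "evaluates P \<rho> e u c \<Longrightarrow> u \<noteq> Leaf \<Longrightarrow> evaluates P \<rho> e1 v c1 \<Longrightarrow>
    evaluates P \<rho> (If_Exp e e1 e2) v (c + c1 + 1 + dsize v)"
| If_false: "evaluates P \<rho> e Leaf c \<Longrightarrow> evaluates P \<rho> e2 v c2 \<Longrightarrow>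
    evaluates P \<rho> (If_Exp e e1 e2) v (c + c2 + 1 + dsize v)"
| Call: "evaluates_list P \<rho> es vs c \<Longrightarrow> f < length P \<Longrightarrow> evaluates P vs (P ! f) v c' \<Longrightarrow>
    evaluates P \<rho> (Call_Exp f es) v (c + c' + 1 + dsize v)"
| Args_Nil: "evaluates_list P \<rho> [] [] 0"
| Args_Cons: "evaluates P \<rho> e v c \<Longrightarrow> evaluates_list P \<rho> es vs cs \<Longrightarrow>
    evaluates_list P \<rho> (e # es) (v # vs) (c + cs)"

definition run :: "program \<Rightarrow> data \<Rightarrow> data \<Rightarrow> nat \<Rightarrow> bool" where
  "run P d out c \<longleftrightarrow> evaluates P [d] (Call_Exp 0 [Var_Exp 0]) out c"

inductive_cases evaluatesE:
  "evaluates P \<rho> (Var_Exp i) v c"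
  "evaluates P \<rho> (Quote_Exp d) v c"
  "evaluates P \<rho> (Cons_Exp e1 e2) v c"
  "evaluates P \<rho> (Hd_Exp e) v c"
  "evaluates P \<rho> (Tl_Exp e) v c"
  "evaluates P \<rho> (Eq_Exp e1 e2) v c"
  "evaluates P \<rho> (If_Exp e e1 e2) v c"
  "evaluates P \<rho> (Call_Exp f es) v c"

inductive_cases evaluates_listE:
  "evaluates_list P \<rho> [] vs c"
  "evaluates_list P \<rho> (e # es) vs c"

lemma evaluates_deterministic:
  "evaluates P \<rho> e v c \<Longrightarrow> evaluates P \<rho> e v' c' \<Longrightarrow> v = v' \<and> c = c'"
  "evaluates_list P \<rho> es vs cs \<Longrightarrow> evaluates_list P \<rho> es vs' cs' \<Longrightarrow> vs = vs' \<and> cs = cs'"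
proof (induction arbitrary: v' c' and vs' cs' rule: evaluates_evaluates_list.inducts)
  case Var
  then show ?case by (auto elim: evaluatesE)
next
  case Quote
  then show ?case by (auto elim: evaluatesE)
next
  case Cons
  from Cons.prems show ?case by (elim evaluatesE) (auto dest!: Cons.IH(2,4))
next
  case Hd
  from Hd.prems show ?case by (elim evaluatesE) (auto dest!: Hd.IH(2))
next
  case Tl
  from Tl.prems show ?case by (elim evaluatesE) (auto dest!: Tl.IH(2))
next
  case Eq
  from Eq.prems show ?case by (elim evaluatesE) (auto dest!: Eq.IH(2,4))
next
  case If_true
  from If_true.prems show ?case using If_true.hyps
    by (elim evaluatesE) (auto dest!: If_true.IH(2,4))
next
  case If_false
  from If_false.prems show ?case by (elim evaluatesE) (auto dest!: If_false.IH(2,4))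
next
  case Call
  from Call.prems show ?case by (elim evaluatesE) (auto dest!: Call.IH(2,5))
next
  case Args_Nil
  then show ?case by (auto elim: evaluates_listE)
next
  case Args_Cons
  from Args_Cons.prems show ?case by (elim evaluates_listE) (auto dest!: Args_Cons.IH(2,4))
qed


section \<open>Representation of proofs as trees\<close>

fun data_of_list :: "data list \<Rightarrow> data" where
  "data_of_list [] = Leaf"
| "data_of_list (d # ds) = Fork d (data_of_list ds)"

text \<open>Binary notation, least significant bit first.\<close>

fun data_of_nat :: "nat \<Rightarrow> data" where
  "data_of_nat n =
     (if n = 0 then Leaf else Fork (truth (odd n)) (data_of_nat (n div 2)))"

declare data_of_nat.simps [simp del]

primrec data_of_fm :: "('a \<Rightarrow> data) \<Rightarrow> 'a fm \<Rightarrow> data" where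
  "data_of_fm f (Atom a) = Fork (data_of_nat 0) (f a)"
| "data_of_fm f Top = Fork (data_of_nat 1) Leaf"
| "data_of_fm f Bot = Fork (data_of_nat 2) Leaf"
| "data_of_fm f (And A B) = Fork (data_of_nat 3) (Fork (data_of_fm f A) (data_of_fm f B))"
| "data_of_fm f (Or A B) = Fork (data_of_nat 4) (Fork (data_of_fm f A) (data_of_fm f B))"
| "data_of_fm f (Imp A B) = Fork (data_of_nat 5) (Fork (data_of_fm f A) (data_of_fm f B))"
| "data_of_fm f (Box A) = Fork (data_of_nat 6) (data_of_fm f A)"
| "data_of_fm f (Dia A) = Fork (data_of_nat 7) (data_of_fm f A)"

definition data_of_form :: "form \<Rightarrow> data" where
  "data_of_form = data_of_fm data_of_nat"

primrec data_of_plus_atom :: "plus_atom \<Rightarrow> data" where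
  "data_of_plus_atom (Base p) = Fork (data_of_nat 0) (data_of_nat p)"
| "data_of_plus_atom (Angled A) = Fork (data_of_nat 1) (data_of_form A)"

definition data_of_form_plus :: "form_plus \<Rightarrow> data" where
  "data_of_form_plus = data_of_fm data_of_plus_atom"

text \<open>
  A multiset is written down by listing its elements in some order, so a multiset, and
  hence a proof, has several representations.
\<close>

definition represents_mset :: "('x \<Rightarrow> data) \<Rightarrow> data \<Rightarrow> 'x multiset \<Rightarrow> bool" where
  "represents_mset f d M \<longleftrightarrow> (\<exists>xs. mset xs = M \<and> d = data_of_list (map f xs))"

inductive represents_proof :: "data \<Rightarrow> nat proof_tree \<Rightarrow> bool" where
  "represents_mset data_of_form d1 \<Gamma> \<Longrightarrow> represents_mset data_of_form d2 \<Delta> \<Longrightarrow>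
   list_all2 represents_proof ds \<pi>s \<Longrightarrow>
   represents_proof (Fork (Fork d1 d2) (data_of_list ds)) (Proof_Tree (\<Gamma>, \<Delta>) \<pi>s)"

definition represents_output :: "data \<Rightarrow> form_plus multiset \<Rightarrow> nat proof_tree \<Rightarrow> bool" where
  "represents_output d M \<sigma> \<longleftrightarrow>
     (\<exists>d1 d2. d = Fork d1 d2 \<and> represents_mset data_of_form_plus d1 M \<and> represents_proof d2 \<sigma>)"

text \<open>Representations are unambiguous.\<close>

lemma data_of_list_inject: "data_of_list ds = data_of_list es \<Longrightarrow> ds = es"
proof (induction ds arbitrary: es)
  case Nil
  then show ?case by (cases es) auto
next
  case (Cons d ds)
  then show ?case by (cases es) auto
qed

lemma data_of_nat_inject: "data_of_nat m = data_of_nat n \<Longrightarrow> m = n"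
proof (induction m arbitrary: n rule: less_induct)
  case (less m)
  show ?case
  proof (cases "m = 0 \<or> n = 0")
    case True
    with less.prems show ?thesis
      by (auto simp: data_of_nat.simps[of m] data_of_nat.simps[of n] split: if_splits)
  next
    case False
    with less.prems have "truth (odd m) = truth (odd n)"
      and "data_of_nat (m div 2) = data_of_nat (n div 2)"
      by (auto simp: data_of_nat.simps[of m] data_of_nat.simps[of n])
    with False less.IH[of "m div 2" "n div 2"] have "odd m = odd n" "m div 2 = n div 2"
      by (auto simp: truth_def split: if_splits)
    then show ?thesis
      by (metis odd_two_times_div_two_succ even_two_times_div_two)
  qed
qed

lemma data_of_nat_eq_iff [simp]: "data_of_nat m = data_of_nat n \<longleftrightarrow> m = n"
  using data_of_nat_inject by blast

lemma data_of_fm_inject: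
  assumes "inj f"
  shows "data_of_fm f A = data_of_fm f B \<Longrightarrow> A = B"
proof (induction A arbitrary: B)
  case (Atom a)
  with assms show ?case by (cases B) (auto dest: injD)
next
  case Top
  then show ?case by (cases B) auto
next
  case Bot
  then show ?case by (cases B) auto
next
  case (And A1 A2)
  from And.prems show ?case by (cases B) (auto dest: And.IH)
next
  case (Or A1 A2)
  from Or.prems show ?case by (cases B) (auto dest: Or.IH)
next
  case (Imp A1 A2)
  from Imp.prems show ?case by (cases B) (auto dest: Imp.IH)
next
  case (Box A)
  from Box.prems show ?case by (cases B) (auto dest: Box.IH)
next
  case (Dia A)
  from Dia.prems show ?case by (cases B) (auto dest: Dia.IH)
qed

lemma inj_data_of_form: "inj data_of_form"
  unfolding data_of_form_def by (intro injI data_of_fm_inject[of data_of_nat]) auto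

lemma inj_data_of_plus_atom: "inj data_of_plus_atom"
proof (rule injI)
  fix a b
  assume "data_of_plus_atom a = data_of_plus_atom b"
  then show "a = b"
    by (cases a; cases b) (auto dest: injD[OF inj_data_of_form])
qed

lemma inj_data_of_form_plus: "inj data_of_form_plus"
  unfolding data_of_form_plus_def
  by (intro injI data_of_fm_inject[OF inj_data_of_plus_atom])

lemma represents_mset_unique:
  assumes "inj f" "represents_mset f d M" "represents_mset f d N"
  shows "M = N"
proof -
  from assms(2,3) obtain xs ys where "mset xs = M" "mset ys = N"
    and "data_of_list (map f xs) = data_of_list (map f ys)"
    by (auto simp: represents_mset_def)
  then show ?thesis
    using data_of_list_inject inj_map_eq_map[OF assms(1)] by metis
qed

lemma represents_proof_unique:
  "represents_proof d \<pi> \<Longrightarrow> represents_proof d \<pi>' \<Longrightarrow> \<pi> = \<pi>'"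
proof (induction arbitrary: \<pi>' rule: represents_proof.induct)
  case (1 d1 \<Gamma> d2 \<Delta> ds \<pi>s)
  from 1(4) obtain \<Gamma>' \<Delta>' \<pi>s' where \<pi>': "\<pi>' = Proof_Tree (\<Gamma>', \<Delta>') \<pi>s'"
    and *: "represents_mset data_of_form d1 \<Gamma>'" "represents_mset data_of_form d2 \<Delta>'"
      "list_all2 represents_proof ds \<pi>s'"
    by (cases rule: represents_proof.cases) (auto dest: data_of_list_inject)
  have "\<Gamma> = \<Gamma>'"
    by (rule represents_mset_unique[OF inj_data_of_form 1(1) *(1)])
  moreover have "\<Delta> = \<Delta>'"
    by (rule represents_mset_unique[OF inj_data_of_form 1(2) *(2)])
  moreover have "\<pi>s = \<pi>s'"
  proof (rule nth_equalityI)
    show "length \<pi>s = length \<pi>s'"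
      using list_all2_lengthD[OF 1(3)] list_all2_lengthD[OF *(3)] by simp
    fix i assume "i < length \<pi>s"
    then show "\<pi>s ! i = \<pi>s' ! i"
      using 1(3) *(3) unfolding list_all2_conv_all_nth by simp
  qed
  ultimately show ?case by (simp add: \<pi>')
qed

lemma represents_output_unique:
  "represents_output d M \<sigma> \<Longrightarrow> represents_output d N \<tau> \<Longrightarrow> M = N \<and> \<sigma> = \<tau>"
  by (auto simp: represents_output_def
      intro: represents_mset_unique[OF inj_data_of_form_plus] represents_proof_unique)

end

theory Submission
  imports Defs
begin

text \<open>
  A formula \<open>F\<close> translates to the same formula over angled atoms, strengthened at every
  subformula \<open>G\<close> by the atom \<open>\<langle>G\<rangle>\<close>. Rules other than left rules therefore only need the
  additional atom \<open>\<langle>F\<rangle>\<close> of their succedent, and for every node \<open>G\<^sub>1, \<dots>, G\<^sub>k \<Rightarrow> F\<close> of the given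
  proof this is supplied by the Horn formula \<open>\<langle>G\<^sub>1\<rangle> \<rightarrow> \<dots> \<rightarrow> \<langle>G\<^sub>k\<rangle> \<rightarrow> \<langle>F\<rangle>\<close>, whose standard
  substitution follows from the subproof ending in that node. So the algorithm need not know
  which rule was applied.

  The remaining case is an instance \<open>A[f]\<close> of an axiom. In the extended language
  \<open>A[f\<^sup>t]\<close> is an axiom instance too, and for constructive \<open>A\<close> it yields \<open>A[f]\<^sup>t\<close> with the help of
  \<open>\<langle>A[f]\<rangle>\<close> and of Horn formulas that are local to the subformulas of \<open>A[f]\<close> and valid outright:
  \<open>\<langle>B\<rangle> \<rightarrow> \<langle>C\<rangle> \<rightarrow> \<langle>B \<and> C\<rangle>\<close>, \<open>\<langle>B\<rangle> \<rightarrow> \<langle>B \<or> C\<rangle>\<close>, \<open>\<diamond>\<langle>B\<rangle> \<rightarrow> \<langle>\<diamond>B\<rangle>\<close> introduce the atoms of basic formulas, and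
  \<open>\<langle>B \<and> C\<rangle> \<rightarrow> \<langle>B\<rangle>\<close>, \<open>\<langle>B \<rightarrow> C\<rangle> \<rightarrow> \<langle>B\<rangle> \<rightarrow> \<langle>C\<rangle>\<close>, \<open>\<langle>\<box>B\<rangle> \<rightarrow> \<box>\<langle>B\<rangle>\<close> decompose \<open>\<langle>A[f]\<rangle>\<close>. Modal rules and nested
  modalities are handled by prefixing all these formulas with up to \<open>n\<close> boxes, where \<open>n\<close> is the
  number of the formulas.
\<close>

section \<open>Polynomial-time functions on trees\<close>

definition poly_bound :: "(nat \<Rightarrow> nat) \<Rightarrow> bool" where
  "poly_bound b \<longleftrightarrow> (\<exists>p :: nat poly. b = poly p)"

lemma poly_bound_const: "poly_bound (\<lambda>n. k)"
  unfolding poly_bound_def by (rule exI[of _ "[:k:]"]) auto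

lemma poly_bound_id: "poly_bound (\<lambda>n. n)"
  unfolding poly_bound_def by (rule exI[of _ "[:0, 1:]"]) auto

lemma poly_bound_add: "poly_bound f \<Longrightarrow> poly_bound g \<Longrightarrow> poly_bound (\<lambda>n. f n + g n)"
  unfolding poly_bound_def using poly_add by (metis (no_types, lifting) ext)

lemma poly_bound_mult: "poly_bound f \<Longrightarrow> poly_bound g \<Longrightarrow> poly_bound (\<lambda>n. f n * g n)"
  unfolding poly_bound_def using poly_mult by (metis (no_types, lifting) ext)

lemma poly_bound_comp:
  assumes "poly_bound f" "poly_bound g"
  shows "poly_bound (\<lambda>n. f (g n))"
proof -
  from assms obtain p q where "f = poly p" "g = poly q"
    unfolding poly_bound_def by blast
  then have "(\<lambda>n. f (g n)) = poly (pcompose p q)" by (auto simp: poly_pcompose)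
  then show ?thesis unfolding poly_bound_def by blast
qed

lemmas poly_bound_intros =
  poly_bound_const poly_bound_id poly_bound_add poly_bound_mult

text \<open>Coefficients are natural numbers, so every bound is monotone. This is what allows bounds
  to be composed and sizes to be replaced by upper estimates.\<close>

lemma poly_bound_mono:
  assumes "poly_bound b" "m \<le> n"
  shows "b m \<le> b n"
proof -
  have "poly p m \<le> poly p n" for p :: "nat poly"
    using \<open>m \<le> n\<close> by (induction p) (auto intro!: add_mono mult_mono)
  with assms(1) show ?thesis unfolding poly_bound_def by blast
qed

lemma dsize_pos: "dsize d \<ge> 1"
  by (cases d) auto

lemma dsize_head_le: "dsize (head d) \<le> dsize d"
  by (cases d) auto

lemma dsize_tail_le: "dsize (tail d) \<le> dsize d"
  by (cases d) auto

text \<open>Every step is charged the size of its value, so a bound on the cost is also a bound on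
  the size of the result.\<close>

lemma dsize_le_cost: "evaluates P \<rho> e v c \<Longrightarrow> dsize v \<le> c"
  by (cases rule: evaluates.cases) auto

section \<open>Relocation of programs\<close>

primrec shift :: "nat \<Rightarrow> exp \<Rightarrow> exp" where
  "shift k (Var_Exp i) = Var_Exp i"
| "shift k (Quote_Exp d) = Quote_Exp d"
| "shift k (Cons_Exp e1 e2) = Cons_Exp (shift k e1) (shift k e2)"
| "shift k (Hd_Exp e) = Hd_Exp (shift k e)"
| "shift k (Tl_Exp e) = Tl_Exp (shift k e)"
| "shift k (Eq_Exp e1 e2) = Eq_Exp (shift k e1) (shift k e2)"
| "shift k (If_Exp e e1 e2) = If_Exp (shift k e) (shift k e1) (shift k e2)"
| "shift k (Call_Exp f es) = Call_Exp (k + f) (map (shift k) es)"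

text \<open>Calls refer to absolute positions in the program. Moving \<open>P\<close> behind
  \<open>A\<close> and renumbering its calls preserves values and costs, so separately written
  functions can share one program.\<close>

lemma evaluates_shift:
  "evaluates P \<rho> e v c \<Longrightarrow>
     evaluates (A @ map (shift (length A)) P) \<rho> (shift (length A) e) v c"
  "evaluates_list P \<rho> es vs c \<Longrightarrow>
     evaluates_list (A @ map (shift (length A)) P) \<rho> (map (shift (length A)) es) vs c"
proof (induction rule: evaluates_evaluates_list.inducts)
  case (Call \<rho> es vs c f v c')
  then show ?case
    unfolding shift.simps by (intro evaluates_evaluates_list.Call) simp_all
qed (simp_all only: shift.simps list.map, (rule evaluates_evaluates_list.intros; assumption)+)

lemma evaluates_append:
  "evaluates P \<rho> e v c \<Longrightarrow> evaluates (P @ Q) \<rho> e v c"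
  "evaluates_list P \<rho> es vs c \<Longrightarrow> evaluates_list (P @ Q) \<rho> es vs c"
proof (induction rule: evaluates_evaluates_list.inducts)
  case (Call \<rho> es vs c f v c')
  then show ?case
    by (intro evaluates_evaluates_list.Call) (simp_all add: nth_append)
qed (rule evaluates_evaluates_list.intros; assumption)+

definition implements :: "program \<Rightarrow> exp \<Rightarrow> (nat \<Rightarrow> nat) \<Rightarrow> (data \<Rightarrow> data) \<Rightarrow> bool" where
  "implements P e b f \<longleftrightarrow> poly_bound b \<and> (\<forall>d. \<exists>c \<le> b (dsize d). evaluates P [d] e (f d) c)"

definition poly_time :: "(data \<Rightarrow> data) \<Rightarrow> bool" where
  "poly_time f \<longleftrightarrow> (\<exists>P e b. implements P e b f)"

lemma implements_append: "implements P e b f \<Longrightarrow> implements (P @ Q) e b f"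
  unfolding implements_def using evaluates_append(1) by blast

lemma implements_shift:
  "implements P e b f \<Longrightarrow> implements (A @ map (shift (length A)) P) (shift (length A) e) b f"
  unfolding implements_def using evaluates_shift(1) by blast

text \<open>Combining several functions in one expression requires a common program: the program of
  the next function is shifted behind the one built so far.\<close>

lemma poly_time_extend:
  assumes "poly_time f"
  obtains Q e b where "implements (P @ Q) e b f"
  using assms implements_shift unfolding poly_time_def by blast

lemma implementsE:
  assumes "implements P e b f"
  obtains c where "c \<le> b (dsize d)" "evaluates P [d] e (f d) c" "dsize (f d) \<le> b (dsize d)"
  using assms unfolding implements_def by (meson dsize_le_cost order_trans)

lemma poly_time_dsize:
  assumes "poly_time f"
  shows "\<exists>b. poly_bound b \<and> (\<forall>d. dsize (f d) \<le> b (dsize d))"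
  using assms unfolding poly_time_def by (metis implementsE implements_def)

section \<open>Closure properties of polynomial-time functions\<close>

lemma poly_time_id: "poly_time (\<lambda>d. d)"
proof -
  have "implements [] (Var_Exp 0) (\<lambda>n. 1 + n) (\<lambda>d. d)"
    unfolding implements_def
    by (auto intro!: poly_bound_intros exI[of _ "Suc (dsize _)"]
        evaluates_evaluates_list.Var[of 0 "[_]", simplified])
  then show ?thesis unfolding poly_time_def by blast
qed

lemma poly_time_const: "poly_time (\<lambda>d. v)"
proof -
  have "implements [] (Quote_Exp v) (\<lambda>n. 1 + dsize v) (\<lambda>d. v)"
    unfolding implements_def
    by (blast intro: poly_bound_intros evaluates_evaluates_list.Quote)
  then show ?thesis unfolding poly_time_def by blast
qed

lemma poly_time_head:
  assumes "poly_time f"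
  shows "poly_time (\<lambda>d. head (f d))"
proof -
  from assms obtain P e b where f: "implements P e b f" unfolding poly_time_def by blast
  have "implements P (Hd_Exp e) (\<lambda>n. b n + 1 + b n) (\<lambda>d. head (f d))"
    unfolding implements_def
  proof (intro conjI allI)
    show "poly_bound (\<lambda>n. b n + 1 + b n)"
      by (intro poly_bound_intros) (use f in \<open>simp_all add: implements_def\<close>)
    fix d
    obtain c where "c \<le> b (dsize d)" "evaluates P [d] e (f d) c" "dsize (f d) \<le> b (dsize d)"
      using f by (rule implementsE)
    then show "\<exists>c\<le>b (dsize d) + 1 + b (dsize d). evaluates P [d] (Hd_Exp e) (head (f d)) c"
      using dsize_head_le[of "f d"]
      by (intro exI[of _ "c + 1 + dsize (head (f d))"])
        (auto intro!: evaluates_evaluates_list.Hd simp del: One_nat_def)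
  qed
  then show ?thesis unfolding poly_time_def by blast
qed

lemma poly_time_tail:
  assumes "poly_time f"
  shows "poly_time (\<lambda>d. tail (f d))"
proof -
  from assms obtain P e b where f: "implements P e b f" unfolding poly_time_def by blast
  have "implements P (Tl_Exp e) (\<lambda>n. b n + 1 + b n) (\<lambda>d. tail (f d))"
    unfolding implements_def
  proof (intro conjI allI)
    show "poly_bound (\<lambda>n. b n + 1 + b n)"
      by (intro poly_bound_intros) (use f in \<open>simp_all add: implements_def\<close>)
    fix d
    obtain c where "c \<le> b (dsize d)" "evaluates P [d] e (f d) c" "dsize (f d) \<le> b (dsize d)"
      using f by (rule implementsE)
    then show "\<exists>c\<le>b (dsize d) + 1 + b (dsize d). evaluates P [d] (Tl_Exp e) (tail (f d)) c"
      using dsize_tail_le[of "f d"]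
      by (intro exI[of _ "c + 1 + dsize (tail (f d))"])
        (auto intro!: evaluates_evaluates_list.Tl simp del: One_nat_def)
  qed
  then show ?thesis unfolding poly_time_def by blast
qed

lemma poly_time_pair_implements:
  assumes "poly_time f" "poly_time g"
  obtains P e1 b1 e2 b2 where "implements P e1 b1 f" "implements P e2 b2 g"
    "poly_bound b1" "poly_bound b2"
proof -
  from assms(1) obtain P e1 b1 where f: "implements P e1 b1 f" unfolding poly_time_def by blast
  from assms(2) obtain Q e2 b2 where g: "implements (P @ Q) e2 b2 g" by (rule poly_time_extend)
  show thesis
    using that[OF implements_append[OF f] g] f g unfolding implements_def by blast
qed

lemma poly_time_Fork:
  assumes "poly_time f" "poly_time g"
  shows "poly_time (\<lambda>d. Fork (f d) (g d))"
proof -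
  obtain P e1 b1 e2 b2 where f: "implements P e1 b1 f" and g: "implements P e2 b2 g"
    and b: "poly_bound b1" "poly_bound b2"
    using assms by (rule poly_time_pair_implements)
  have "implements P (Cons_Exp e1 e2) (\<lambda>n. 2 * b1 n + 2 * b2 n + 2) (\<lambda>d. Fork (f d) (g d))"
    unfolding implements_def
  proof (intro conjI allI)
    show "poly_bound (\<lambda>n. 2 * b1 n + 2 * b2 n + 2)"
      by (intro poly_bound_intros b)
    fix d
    obtain c where c: "c \<le> b1 (dsize d)" "evaluates P [d] e1 (f d) c" "dsize (f d) \<le> b1 (dsize d)"
      using f by (rule implementsE)
    obtain c' where c': "c' \<le> b2 (dsize d)" "evaluates P [d] e2 (g d) c'" "dsize (g d) \<le> b2 (dsize d)"
      using g by (rule implementsE)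
    show "\<exists>c\<le>2 * b1 (dsize d) + 2 * b2 (dsize d) + 2.
        evaluates P [d] (Cons_Exp e1 e2) (Fork (f d) (g d)) c"
      using evaluates_evaluates_list.Cons[OF c(2) c'(2)] c c'
      by (intro exI conjI) (auto simp del: One_nat_def)
  qed
  then show ?thesis unfolding poly_time_def by blast
qed

lemma dsize_truth: "dsize (truth b) \<le> 3"
  by (auto simp: truth_def)

lemma poly_time_if_eq:
  assumes "poly_time f1" "poly_time f2" "poly_time g1" "poly_time g2"
  shows "poly_time (\<lambda>d. if f1 d = f2 d then g1 d else g2 d)"
proof -
  obtain P e1 b1 e2 b2 where f1: "implements P e1 b1 f1" and f2: "implements P e2 b2 f2"
    and b: "poly_bound b1" "poly_bound b2"
    using assms(1,2) by (rule poly_time_pair_implements)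
  obtain P3 e3 b3 where g1: "implements (P @ P3) e3 b3 g1" using assms(3) by (rule poly_time_extend)
  obtain P4 e4 b4 where g2: "implements ((P @ P3) @ P4) e4 b4 g2"
    using assms(4) by (rule poly_time_extend)
  define Q where "Q = (P @ P3) @ P4"
  have imps: "implements Q e1 b1 f1" "implements Q e2 b2 f2" "implements Q e3 b3 g1"
    "implements Q e4 b4 g2"
    unfolding Q_def using f1 f2 g1 g2 implements_append by blast+
  have b': "poly_bound b3" "poly_bound b4" using g1 g2 unfolding implements_def by auto
  define b where "b = (\<lambda>n. b1 n + b2 n + 2 * b3 n + 2 * b4 n + 5)"
  have "implements Q (If_Exp (Eq_Exp e1 e2) e3 e4) b (\<lambda>d. if f1 d = f2 d then g1 d else g2 d)"
    unfolding implements_def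
  proof (intro conjI allI)
    show "poly_bound b"
      unfolding b_def by (intro poly_bound_intros b b')
    fix d
    obtain c1 where c1: "c1 \<le> b1 (dsize d)" "evaluates Q [d] e1 (f1 d) c1"
      using imps(1) by (rule implementsE)
    obtain c2 where c2: "c2 \<le> b2 (dsize d)" "evaluates Q [d] e2 (f2 d) c2"
      using imps(2) by (rule implementsE)
    obtain c3 where c3: "c3 \<le> b3 (dsize d)" "evaluates Q [d] e3 (g1 d) c3" "dsize (g1 d) \<le> b3 (dsize d)"
      using imps(3) by (rule implementsE)
    obtain c4 where c4: "c4 \<le> b4 (dsize d)" "evaluates Q [d] e4 (g2 d) c4" "dsize (g2 d) \<le> b4 (dsize d)"
      using imps(4) by (rule implementsE)
    note E = evaluates_evaluates_list.Eq[OF c1(2) c2(2)]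
    show "\<exists>c\<le>b (dsize d). evaluates Q [d] (If_Exp (Eq_Exp e1 e2) e3 e4)
        (if f1 d = f2 d then g1 d else g2 d) c"
    proof (cases "f1 d = f2 d")
      case True
      then have "truth (f1 d = f2 d) \<noteq> Leaf" by (auto simp: truth_def)
      from evaluates_evaluates_list.If_true[OF E this c3(2), of e4] True c1 c2 c3
        dsize_truth[of "f1 d = f2 d"]
      show ?thesis unfolding b_def by (intro exI conjI) (auto simp del: One_nat_def)
    next
      case False
      then have t: "truth (f1 d = f2 d) = Leaf" by (auto simp: truth_def)
      from evaluates_evaluates_list.If_false[OF E[unfolded t] c4(2), of e3] False c1 c2 c4
      show ?thesis unfolding b_def by (intro exI conjI) (auto simp del: One_nat_def)
    qed
  qed
  then show ?thesis unfolding poly_time_def by blast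
qed

lemma poly_time_comp:
  assumes "poly_time g" "poly_time f"
  shows "poly_time (\<lambda>d. g (f d))"
proof -
  obtain P e1 b1 e2 b2 where f: "implements P e1 b1 f" and g: "implements P e2 b2 g"
    and b: "poly_bound b1" "poly_bound b2"
    using assms(2,1) by (rule poly_time_pair_implements)
  \<comment> \<open>Variable 0 of \<open>e2\<close> has to denote \<open>f d\<close>, so
    \<open>e2\<close> becomes the body of a new function, at position
    \<open>length P\<close>.\<close>
  define Q where "Q = P @ [e2]"
  have f: "implements Q e1 b1 f" and g: "implements Q e2 b2 g"
    unfolding Q_def using f g implements_append by blast+
  define b where "b = (\<lambda>n. b1 n + 2 * b2 (b1 n) + 1)"
  have "implements Q (Call_Exp (length P) [e1]) b (\<lambda>d. g (f d))"
    unfolding implements_def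
  proof (intro conjI allI)
    show "poly_bound b"
      unfolding b_def by (intro poly_bound_intros b poly_bound_comp[OF b(2,1)])
    fix d
    obtain c1 where c1: "c1 \<le> b1 (dsize d)" "evaluates Q [d] e1 (f d) c1" "dsize (f d) \<le> b1 (dsize d)"
      using f by (rule implementsE)
    obtain c2 where c2: "c2 \<le> b2 (dsize (f d))" "evaluates Q [f d] e2 (g (f d)) c2"
      "dsize (g (f d)) \<le> b2 (dsize (f d))"
      using g by (rule implementsE)
    have le: "b2 (dsize (f d)) \<le> b2 (b1 (dsize d))"
      using c1(3) poly_bound_mono \<open>poly_bound b2\<close> by blast
    have args: "evaluates_list Q [d] [e1] [f d] (c1 + 0)"
      using c1(2) by (intro evaluates_evaluates_list.Args_Cons evaluates_evaluates_list.Args_Nil)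
    have "evaluates Q [d] (Call_Exp (length P) [e1]) (g (f d)) (c1 + 0 + c2 + 1 + dsize (g (f d)))"
      by (rule evaluates_evaluates_list.Call[OF args]) (use c2 in \<open>auto simp: Q_def\<close>)
    then show "\<exists>c\<le>b (dsize d). evaluates Q [d] (Call_Exp (length P) [e1]) (g (f d)) c"
      using c1 c2 le unfolding b_def by (intro exI conjI) (auto simp del: One_nat_def)
  qed
  then show ?thesis unfolding poly_time_def by blast
qed

definition poly_time2 :: "(data \<Rightarrow> data \<Rightarrow> data) \<Rightarrow> bool" where
  "poly_time2 h \<longleftrightarrow> poly_time (\<lambda>d. h (head d) (tail d))"

lemma poly_time_comp2:
  assumes "poly_time2 h" "poly_time f" "poly_time g"
  shows "poly_time (\<lambda>d. h (f d) (g d))"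
  using poly_time_comp[OF assms(1)[unfolded poly_time2_def] poly_time_Fork[OF assms(2,3)]] by simp

lemmas poly_time_intros =
  poly_time_id poly_time_const poly_time_head poly_time_tail poly_time_Fork poly_time_if_eq

text \<open>
  As each step adds only polynomially many symbols to the results of the recursive calls,
  the values stay of polynomial size; there are at most \<^term>\<open>dsize x\<close> calls.
\<close>

lemma poly_time_tree_recursion:
  assumes "poly_time b" "poly_time h1" "poly_time h2"
    and g: "poly_time (\<lambda>d. g (head (head d)) (tail (head d)) (head (tail d)) (tail (tail d)))"
    and Leaf: "\<And>a. f Leaf a = b a"
    and step: "\<And>x a. x \<noteq> Leaf \<Longrightarrow> f x a = g x a (f (h1 x) a) (f (h2 x) a)"
    and dec: "\<And>x. x \<noteq> Leaf \<Longrightarrow> dsize (h1 x) + dsize (h2 x) < dsize x"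
    and r: "poly_bound r" "\<And>x a u v. dsize (g x a u v) \<le> dsize u + dsize v + r (dsize x + dsize a)"
  shows "poly_time2 f"
proof -
  have "poly_time (\<lambda>d. b (tail d))" "poly_time (\<lambda>d. Fork (h1 (head d)) (tail d))"
    "poly_time (\<lambda>d. Fork (h2 (head d)) (tail d))"
    using assms(1-3) by (auto intro!: poly_time_intros intro: poly_time_comp)
  note B = this(1) and H1 = this(2) and H2 = this(3)
  obtain P1 e1 b1 e2 b2 where 1: "implements P1 e1 b1 (\<lambda>d. Fork (h1 (head d)) (tail d))"
    and 2: "implements P1 e2 b2 (\<lambda>d. Fork (h2 (head d)) (tail d))"
    using H1 H2 by (rule poly_time_pair_implements)
  obtain P2 eB bB where 3: "implements (P1 @ P2) eB bB (\<lambda>d. b (tail d))"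
    using B by (rule poly_time_extend)
  obtain P3 eG bG where 4: "implements ((P1 @ P2) @ P3) eG bG
      (\<lambda>d. g (head (head d)) (tail (head d)) (head (tail d)) (tail (tail d)))"
    using g by (rule poly_time_extend)
  define P where "P = (P1 @ P2) @ P3"
  define k where "k = length P"
  define call where "call e = Call_Exp (k + 1) [e]" for e
  \<comment> \<open>Function \<open>k\<close> performs one recursion step and function
    \<open>k + 1\<close> is the recursion itself. Testing the head of the argument pair separates
    the base case.\<close>
  define body where
    "body = If_Exp (Hd_Exp (Var_Exp 0))
       (Call_Exp k [Cons_Exp (Var_Exp 0) (Cons_Exp (call e1) (call e2))]) eB"
  define Q where "Q = P @ [eG, body]"
  have imps: "implements Q e1 b1 (\<lambda>d. Fork (h1 (head d)) (tail d))"
    "implements Q e2 b2 (\<lambda>d. Fork (h2 (head d)) (tail d))"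
    "implements Q eB bB (\<lambda>d. b (tail d))"
    "implements Q eG bG (\<lambda>d. g (head (head d)) (tail (head d)) (head (tail d)) (tail (tail d)))"
    unfolding P_def Q_def using 1 2 3 4 implements_append by blast+
  have pb: "poly_bound b1" "poly_bound b2" "poly_bound bB" "poly_bound bG"
    using 1 2 3 4 unfolding implements_def by blast+
  \<comment> \<open>For arguments of total size at most \<open>n\<close>, \<open>s n\<close> bounds
    every result, and \<open>q n\<close> bounds the cost of one call apart from the bodies of its
    two recursive calls.\<close>
  define s where "s = (\<lambda>n. n * (bB (n + 1) + r n))"
  define q where "q = (\<lambda>n. b1 (n + 1) + b2 (n + 1) + 2 * bB (n + 1)
     + bG (n + 3 + 2 * s n) + 6 * n + 9 * s n + 30)"
  have pbs: "poly_bound s" "poly_bound (\<lambda>n. bB (n + 1))" "poly_bound q"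
    unfolding q_def s_def
    by (intro poly_bound_intros pb r(1) poly_bound_comp[OF pb(1)] poly_bound_comp[OF pb(2)]
        poly_bound_comp[OF pb(3)] poly_bound_comp[OF pb(4)])+
  have bB: "dsize (b a) \<le> bB (1 + dsize a + 1)" for a
    using implementsE[OF imps(3), of "Fork Leaf a" thesis for thesis] by (auto simp: add_ac)
  \<comment> \<open>By \<open>dec\<close> the two recursive arguments together leave at least one
    unit of \<open>dsize x\<close> for the call itself. Charging each call to that unit gives a
    bound linear in \<open>dsize x\<close>; \<open>main\<close> repeats the accounting for
    costs.\<close>
  have size: "dsize (f x a) \<le> dsize x * (bB (n + 1) + r n)" if "dsize x + dsize a \<le> n" for x a n
    using that
  proof (induction x rule: measure_induct_rule[of dsize])
    case (less x)
    show ?case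
    proof (cases "x = Leaf")
      case True
      have "bB (1 + dsize a + 1) \<le> bB (n + 1)"
        using less.prems True by (intro poly_bound_mono[OF pb(3)]) simp
      with bB[of a] True show ?thesis by (simp add: Leaf)
    next
      case False
      from dec[OF this] have d: "dsize (h1 x) + dsize (h2 x) + 1 \<le> dsize x" by simp
      let ?w = "bB (n + 1) + r n"
      have "dsize (f (h1 x) a) \<le> dsize (h1 x) * ?w" "dsize (f (h2 x) a) \<le> dsize (h2 x) * ?w"
        using d less.prems less.IH[of "h1 x"] less.IH[of "h2 x"] by auto
      moreover have "r (dsize x + dsize a) \<le> ?w"
        using poly_bound_mono[OF r(1) less.prems] by simp
      ultimately have "dsize (f x a) \<le> (dsize (h1 x) + dsize (h2 x) + 1) * ?w"
        using r(2)[of x a "f (h1 x) a" "f (h2 x) a"] False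
        by (simp add: step add_mult_distrib)
      also have "\<dots> \<le> dsize x * ?w" using d by (rule mult_right_mono) simp
      finally show ?thesis .
    qed
  qed
  have s: "dsize (f x a) \<le> s n" if "dsize x + dsize a \<le> n" for x a n
  proof -
    have "dsize x * (bB (n + 1) + r n) \<le> n * (bB (n + 1) + r n)"
      using that by (intro mult_right_mono) auto
    with size[OF that] show ?thesis unfolding s_def by linarith
  qed
  have nth: "k < length Q" "Q ! k = eG" "k + 1 < length Q" "Q ! (k + 1) = body"
    by (auto simp: Q_def k_def nth_append)
  have Var: "evaluates Q [d] (Var_Exp 0) d (1 + dsize d)" for d
    using evaluates_evaluates_list.Var[of 0 "[d]" Q] by simp
  have call: "evaluates Q \<rho> (call e) v (c + c' + 1 + dsize v)"
    if "evaluates Q \<rho> e u c" "evaluates Q [u] body v c'" for e u v c c' \<rho>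
  proof -
    have "evaluates_list Q \<rho> [e] [u] (c + 0)"
      using that by (intro evaluates_evaluates_list.Args_Cons evaluates_evaluates_list.Args_Nil)
    from evaluates_evaluates_list.Call[OF this nth(3), unfolded nth(4), OF that(2)]
    show ?thesis unfolding call_def by simp
  qed
  have main: "\<exists>c \<le> dsize x * q n. evaluates Q [Fork x a] body (f x a) c"
    if "dsize x + dsize a \<le> n" for x a n
    using that
  proof (induction x rule: measure_induct_rule[of dsize])
    case (less x)
    have Hd: "evaluates Q [Fork x a] (Hd_Exp (Var_Exp 0)) x
        (1 + dsize (Fork x a) + 1 + dsize x)"
      using evaluates_evaluates_list.Hd[OF Var[of "Fork x a"]] by simp
    show ?case
    proof (cases "x = Leaf")
      case True
      obtain c where c: "c \<le> bB (dsize (Fork Leaf a))" "evaluates Q [Fork Leaf a] eB (b a) c"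
        "dsize (b a) \<le> bB (dsize (Fork Leaf a))"
        using implementsE[OF imps(3), of "Fork Leaf a" thesis for thesis] by auto
      have "bB (dsize (Fork Leaf a)) \<le> bB (n + 1)"
        using less.prems True by (intro poly_bound_mono[OF pb(3)]) simp
      moreover have "evaluates Q [Fork x a] body (f x a)
          (1 + dsize (Fork x a) + 1 + dsize x + c + 1 + dsize (b a))"
        unfolding body_def True Leaf
        by (rule evaluates_evaluates_list.If_false[OF Hd[unfolded True] c(2)])
      ultimately show ?thesis
        using c less.prems True by (intro exI conjI) (auto simp: q_def simp del: One_nat_def)
    next
      case False
      from dec[OF this] have d: "dsize (h1 x) + dsize (h2 x) + 1 \<le> dsize x" by simp
      let ?d = "Fork x a" and ?u = "f (h1 x) a" and ?v = "f (h2 x) a"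
      have n1: "dsize ?d \<le> n + 1" using less.prems by simp
      obtain c1 where c1: "c1 \<le> b1 (dsize ?d)" "evaluates Q [?d] e1 (Fork (h1 x) a) c1"
        using implementsE[OF imps(1), of ?d thesis for thesis] by auto
      obtain c2 where c2: "c2 \<le> b2 (dsize ?d)" "evaluates Q [?d] e2 (Fork (h2 x) a) c2"
        using implementsE[OF imps(2), of ?d thesis for thesis] by auto
      obtain d1 where d1: "d1 \<le> dsize (h1 x) * q n" "evaluates Q [Fork (h1 x) a] body ?u d1"
        using less.IH[of "h1 x"] less.prems d by auto
      obtain d2 where d2: "d2 \<le> dsize (h2 x) * q n" "evaluates Q [Fork (h2 x) a] body ?v d2"
        using less.IH[of "h2 x"] less.prems d by auto
      have su: "dsize ?u \<le> s n" and sv: "dsize ?v \<le> s n" and sf: "dsize (f x a) \<le> s n"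
        using s less.prems d by auto
      let ?w = "Fork ?d (Fork ?u ?v)"
      obtain cG where cG: "cG \<le> bG (dsize ?w)" "evaluates Q [?w] eG (f x a) cG"
        using implementsE[OF imps(4), of ?w thesis for thesis] False by (auto simp: step)
      have "bG (dsize ?w) \<le> bG (n + 3 + 2 * s n)"
        using less.prems su sv by (intro poly_bound_mono[OF pb(4)]) simp
      moreover have "b1 (dsize ?d) \<le> b1 (n + 1)" "b2 (dsize ?d) \<le> b2 (n + 1)"
        using n1 pb poly_bound_mono by blast+
      ultimately have le: "cG \<le> bG (n + 3 + 2 * s n)" "c1 \<le> b1 (n + 1)" "c2 \<le> b2 (n + 1)"
        using cG(1) c1(1) c2(1) by linarith+
      define cu where "cu = c1 + d1 + 1 + dsize ?u"
      define cv where "cv = c2 + d2 + 1 + dsize ?v"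
      define cw where "cw = 1 + dsize ?d + (cu + cv + 1 + dsize (Fork ?u ?v)) + 1 + dsize ?w"
      have "evaluates Q [?d] (Cons_Exp (Var_Exp 0) (Cons_Exp (call e1) (call e2))) ?w cw"
        unfolding cw_def cu_def cv_def using c1 c2 d1 d2
        by (intro evaluates_evaluates_list.Cons call Var)
      then have "evaluates_list Q [?d] [Cons_Exp (Var_Exp 0) (Cons_Exp (call e1) (call e2))] [?w] (cw + 0)"
        by (intro evaluates_evaluates_list.Args_Cons evaluates_evaluates_list.Args_Nil)
      from evaluates_evaluates_list.Call[OF this nth(1)] cG(2)
      have "evaluates Q [?d] (Call_Exp k [Cons_Exp (Var_Exp 0) (Cons_Exp (call e1) (call e2))])
          (f x a) (cw + 0 + cG + 1 + dsize (f x a))"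
        by (simp add: nth)
      from evaluates_evaluates_list.If_true[OF Hd False this]
      have ev: "evaluates Q [?d] body (f x a) (1 + dsize ?d + 1 + dsize x +
          (cw + 0 + cG + 1 + dsize (f x a)) + 1 + dsize (f x a))" (is "evaluates _ _ _ _ ?c")
        unfolding body_def by simp
      have "?c \<le> d1 + d2 + q n"
        using le su sv sf less.prems unfolding q_def cw_def cu_def cv_def by simp
      also have "\<dots> \<le> (dsize (h1 x) + dsize (h2 x) + 1) * q n"
        using d1(1) d2(1) by (simp add: add_mult_distrib)
      also have "\<dots> \<le> dsize x * q n" using d by (rule mult_right_mono) simp
      finally show ?thesis using ev by blast
    qed
  qed
  \<comment> \<open>The pair is rebuilt from head and tail because \<open>d\<close> may be
    \<open>Leaf\<close>, while \<open>main\<close> treats arguments of the form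
    \<open>Fork x a\<close>. The same case is the reason for taking \<open>2 * n\<close> as the size
    bound.\<close>
  have "implements Q (call (Cons_Exp (Hd_Exp (Var_Exp 0)) (Tl_Exp (Var_Exp 0))))
      (\<lambda>n. 2 * n * q (2 * n) + s (2 * n) + 20 * n + 20) (\<lambda>d. f (head d) (tail d))"
    unfolding implements_def
  proof (intro conjI allI)
    show "poly_bound (\<lambda>n. 2 * n * q (2 * n) + s (2 * n) + 20 * n + 20)"
      by (intro poly_bound_intros poly_bound_comp[OF pbs(1)] poly_bound_comp[OF pbs(3)])
    fix d
    let ?n = "2 * dsize d"
    have ht: "dsize (head d) \<le> dsize d" "dsize (tail d) \<le> dsize d"
      by (fact dsize_head_le dsize_tail_le)+
    then have n: "dsize (head d) + dsize (tail d) \<le> ?n" by simp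
    from main[OF n] obtain c where c: "c \<le> dsize (head d) * q ?n"
      "evaluates Q [Fork (head d) (tail d)] body (f (head d) (tail d)) c" by blast
    have "dsize (head d) * q ?n \<le> ?n * q ?n" using ht by (intro mult_right_mono) auto
    with c(1) have c_le: "c \<le> ?n * q ?n" by linarith
    have pair: "evaluates Q [d] (Cons_Exp (Hd_Exp (Var_Exp 0)) (Tl_Exp (Var_Exp 0))) (Fork (head d) (tail d))
      ((1 + dsize d + 1 + dsize (head d)) + (1 + dsize d + 1 + dsize (tail d)) + 1
        + dsize (Fork (head d) (tail d)))"
      by (intro evaluates_evaluates_list.Cons evaluates_evaluates_list.Hd
          evaluates_evaluates_list.Tl Var)
    from call[OF pair c(2)] c_le s[OF n] ht
    show "\<exists>c\<le>?n * q ?n + s ?n + 20 * dsize d + 20.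
        evaluates Q [d] (call (Cons_Exp (Hd_Exp (Var_Exp 0)) (Tl_Exp (Var_Exp 0))))
          (f (head d) (tail d)) c"
      by (intro exI conjI) (auto simp del: One_nat_def)
  qed
  then show ?thesis unfolding poly_time_def poly_time2_def by blast
qed

text \<open>A list is a tree in which only tails are recursed into: the second recursive argument is
  constantly \<open>Leaf\<close>, and its value is ignored.\<close>

lemma poly_time_list_recursion:
  assumes "poly_time b"
    and g: "poly_time (\<lambda>d. g (head (head d)) (tail (head d)) (tail d))"
    and Leaf: "\<And>a. f Leaf a = b a"
    and step: "\<And>y x a. f (Fork y x) a = g (Fork y x) a (f x a)"
    and r: "poly_bound r" "\<And>x a u. dsize (g x a u) \<le> dsize u + r (dsize x + dsize a)"
  shows "poly_time2 f"
proof (rule poly_time_tree_recursion[where b = b and ?h1.0 = tail and ?h2.0 = "\<lambda>x. Leaf"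
      and g = "\<lambda>x a u v. g x a u" and r = r])
  have "poly_time (\<lambda>d. Fork (head d) (head (tail d)))"
    by (intro poly_time_intros)
  from poly_time_comp[OF g this]
  show "poly_time (\<lambda>d. g (head (head d)) (tail (head d)) (head (tail d)))"
    by simp
  show "dsize (g x a u) \<le> dsize u + dsize v + r (dsize x + dsize a)" for x a u v
    using r(2)[of x a u] by simp
  show "dsize (tail x) + dsize Leaf < dsize x" if "x \<noteq> Leaf" for x
    using that dsize_pos[of "head x"] by (cases x) auto
  show "f x a = g x a (f (tail x) a)" if "x \<noteq> Leaf" for x a
    using that step by (cases x) auto
qed (use assms in \<open>auto intro: poly_time_intros\<close>)

lemma poly_time_run:
  assumes "poly_time f"
  obtains P p where "\<And>d. \<exists>c \<le> poly p (dsize d). run P d (f d) c"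
proof -
  from assms obtain P e b where "implements P e b f" unfolding poly_time_def by blast
  \<comment> \<open>\<open>run\<close> starts function 0, so the main expression is put in front and
    all calls are renumbered by one.\<close>
  define Q where "Q = shift 1 e # map (shift 1) P"
  from implements_shift[OF \<open>implements P e b f\<close>, of "[shift 1 e]"]
  have Q: "implements Q (shift 1 e) b f" by (simp add: Q_def)
  then have "poly_bound b" unfolding implements_def by blast
  then have "poly_bound (\<lambda>n. 2 * b n + n + 2)" by (intro poly_bound_intros)
  then obtain p where p: "(\<lambda>n. 2 * b n + n + 2) = poly p" unfolding poly_bound_def by blast
  have "\<exists>c \<le> poly p (dsize d). run Q d (f d) c" for d
  proof -
    obtain c where c: "c \<le> b (dsize d)" "evaluates Q [d] (shift 1 e) (f d) c"
      "dsize (f d) \<le> b (dsize d)"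
      using Q by (rule implementsE)
    have "evaluates_list Q [d] [Var_Exp 0] [d] (1 + dsize d + 0)"
      using evaluates_evaluates_list.Var[of 0 "[d]" Q]
      by (intro evaluates_evaluates_list.Args_Cons evaluates_evaluates_list.Args_Nil) simp
    from evaluates_evaluates_list.Call[OF this, of 0] c
    have "run Q d (f d) (1 + dsize d + 0 + c + 1 + dsize (f d))"
      unfolding run_def by (simp add: Q_def)
    moreover have "1 + dsize d + 0 + c + 1 + dsize (f d) \<le> poly p (dsize d)"
      unfolding p[symmetric] using c by simp
    ultimately show ?thesis by blast
  qed
  then show thesis using that by blast
qed


section \<open>Provability from sets of formulas\<close>

lemma derivable_rule:
  assumes "CK_plus C Ss S" "\<And>S'. S' \<in> set Ss \<Longrightarrow> derivable C S'"
  shows "derivable C S"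
proof -
  have "\<forall>S'. \<exists>\<pi>. S' \<in> set Ss \<longrightarrow> proof_of C \<pi> S'"
    using assms(2) unfolding derivable_def by blast
  then obtain g where g: "\<And>S'. S' \<in> set Ss \<Longrightarrow> proof_of C (g S') S'" by metis
  then have "map concl (map g Ss) = Ss"
    by (auto intro!: map_idI simp: proof_of_def)
  then have "proof_of C (Proof_Tree S (map g Ss)) S"
    using assms(1) g by (auto simp: proof_of_def)
  then show ?thesis unfolding derivable_def by blast
qed

lemma derivable_LJ:
  "LJ Ss S \<Longrightarrow> (\<And>S'. S' \<in> set Ss \<Longrightarrow> derivable C S') \<Longrightarrow> derivable C S"
  by (blast intro: derivable_rule CK_plus.CK_rule CK.LJ_rule)

lemma derivable_weaken:
  assumes "derivable C (M, \<Delta>)" "size \<Delta> \<le> 1"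
  shows "derivable C (N + M, \<Delta>)"
  using assms(1) by (induction N) (auto intro: derivable_LJ[OF LJ.WkL[OF assms(2)]])

lemma derivable_contract:
  assumes "derivable C (N + M, \<Delta>)" "size \<Delta> \<le> 1" "set_mset N \<subseteq> set_mset M"
  shows "derivable C (M, \<Delta>)"
  using assms(1,3)
proof (induction N)
  case (add A N)
  then obtain M' where M: "M = add_mset A M'" by (metis insert_subset mset_add set_mset_add_mset_insert)
  with add.prems(1) have "derivable C (add_mset A (add_mset A (N + M')), \<Delta>)" by simp
  then have "derivable C (N + M, \<Delta>)"
    unfolding M by (auto intro: derivable_LJ[OF LJ.ConL[OF assms(2)]])
  with add show ?case by auto
qed simp

text \<open>Weaken by all of \<open>N\<close>, then contract the formulas of \<open>M\<close> into
  their copies in \<open>N\<close>.\<close>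

lemma derivable_mono:
  assumes "derivable C (M, \<Delta>)" "size \<Delta> \<le> 1" "set_mset M \<subseteq> set_mset N"
  shows "derivable C (N, \<Delta>)"
  using derivable_contract[of C M N \<Delta>] derivable_weaken[OF assms(1,2), of N] assms(2,3)
  by (simp add: add.commute)

text \<open>With a set of premises, possibly infinite, weakening and contraction become silent. The
  size condition is built in because the left rules ask for it.\<close>

definition entails :: "form set \<Rightarrow> 'a fm set \<Rightarrow> 'a fm multiset \<Rightarrow> bool" where
  "entails C P \<Delta> \<longleftrightarrow> size \<Delta> \<le> 1 \<and> (\<exists>M. set_mset M \<subseteq> P \<and> derivable C (M, \<Delta>))"

lemma entails_size: "entails C P \<Delta> \<Longrightarrow> size \<Delta> \<le> 1"
  by (simp add: entails_def)

lemma entails_mono: "entails C P \<Delta> \<Longrightarrow> P \<subseteq> Q \<Longrightarrow> entails C Q \<Delta>"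
  unfolding entails_def by blast

lemma entails_derivable: "entails C (set_mset M) \<Delta> \<Longrightarrow> derivable C (M, \<Delta>)"
  unfolding entails_def using derivable_mono by blast

text \<open>A left rule acts on one displayed occurrence, whereas a derivation may use
  \<open>A\<close> any number of times. The occurrences are contracted to one, or one is added by
  weakening.\<close>

lemma entails_insertE:
  assumes "entails C (insert A P) \<Delta>"
  obtains M where "set_mset M \<subseteq> P" "derivable C (add_mset A M, \<Delta>)"
proof -
  from assms obtain M where M: "set_mset M \<subseteq> insert A P" "derivable C (M, \<Delta>)" "size \<Delta> \<le> 1"
    unfolding entails_def by blast
  let ?M = "filter_mset (\<lambda>B. B \<noteq> A) M"
  have "derivable C (add_mset A ?M, \<Delta>)"
    using M(2,3) by (rule derivable_mono) auto
  with M(1) show thesis by (intro that[of ?M]) auto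
qed

section \<open>The rules of the calculus for entailment\<close>

lemma entails_ax: "A \<in> P \<Longrightarrow> entails C P {#A#}"
  unfolding entails_def
  using derivable_LJ[OF LJ.Ax[of A "{#}"], of C] by (auto intro!: exI[of _ "{#A#}"])

lemma entails_top: "entails C P {#Top#}"
  unfolding entails_def using derivable_LJ[OF LJ.TopR[of "{#}"], of C]
  by (auto intro!: exI[of _ "{#}"])

lemma entails_cut:
  assumes "entails C P {#A#}" "entails C (insert A P) \<Delta>"
  shows "entails C P \<Delta>"
proof -
  from assms(2) have size: "size \<Delta> \<le> 1" by (rule entails_size)
  obtain M where M: "set_mset M \<subseteq> P" "derivable C (M, {#A#})"
    using assms(1) unfolding entails_def by blast
  obtain N where N: "set_mset N \<subseteq> P" "derivable C (add_mset A N, \<Delta>)"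
    using assms(2) by (rule entails_insertE)
  have "derivable C (N + M, {#A#})" using M(2) by (auto intro: derivable_weaken)
  moreover have "derivable C (add_mset A (N + M), \<Delta>)"
    using derivable_weaken[OF N(2) size, of M] by (simp add: add.commute)
  ultimately have "derivable C (N + M, \<Delta>)"
    by (intro derivable_LJ[OF LJ.Cut[OF size, of "N + M" A]]) auto
  then show ?thesis unfolding entails_def using M(1) N(1) size by (auto intro!: exI[of _ "N + M"])
qed

lemma entails_cut_set:
  assumes "entails C Q \<Delta>" "\<And>A. A \<in> Q \<Longrightarrow> entails C P {#A#}"
  shows "entails C P \<Delta>"
proof -
  obtain M where M: "set_mset M \<subseteq> Q" "derivable C (M, \<Delta>)" and size: "size \<Delta> \<le> 1"
    using assms(1) unfolding entails_def by blast
  have "entails C (set_mset M \<union> P) \<Delta>" using M(2) size unfolding entails_def by blast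
  then show ?thesis using M(1)
  proof (induction M)
    case (add A M)
    have "entails C (set_mset M \<union> P) {#A#}"
      using assms(2)[of A] add.prems(2) by (auto elim: entails_mono)
    with add show ?case by (auto intro: entails_cut)
  qed simp
qed

text \<open>The common pattern of the one-premise left rules: a cut with the principal formula
  \<open>B\<close> makes its immediate part \<open>A\<close> available as a premise.\<close>

lemma entails_left_rule:
  assumes "entails C (insert A P) \<Delta>" "entails C P {#B#}"
    and "\<And>M. derivable C (add_mset A M, \<Delta>) \<Longrightarrow> derivable C (add_mset B M, \<Delta>)"
  shows "entails C P \<Delta>"
proof (rule entails_cut[OF assms(2)])
  obtain M where M: "set_mset M \<subseteq> P" "derivable C (add_mset A M, \<Delta>)"
    using assms(1) by (rule entails_insertE)
  then show "entails C (insert B P) \<Delta>"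
    using assms(3)[OF M(2)] entails_size[OF assms(1)] unfolding entails_def
    by (auto intro!: exI[of _ "add_mset B M"])
qed

lemma entails_andL1: "entails C P {#And A B#} \<Longrightarrow> entails C P {#A#}"
  by (rule entails_left_rule[of C A P _ "And A B"])
    (auto intro: entails_ax derivable_LJ[OF LJ.AndL1])

lemma entails_andL2: "entails C P {#And A B#} \<Longrightarrow> entails C P {#B#}"
  by (rule entails_left_rule[of C B P _ "And A B"])
    (auto intro: entails_ax derivable_LJ[OF LJ.AndL2])

lemma entails_bot:
  assumes "entails C P {#Bot#}" "size \<Delta> \<le> 1"
  shows "entails C P \<Delta>"
proof (rule entails_cut[OF assms(1)])
  show "entails C (insert Bot P) \<Delta>"
    unfolding entails_def using derivable_LJ[OF LJ.BotL[OF assms(2), of "{#}"], of C] assms(2)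
    by (auto intro!: exI[of _ "{#Bot#}"])
qed

lemma entails_weakR:
  assumes "entails C P {#}"
  shows "entails C P {#A#}"
proof -
  obtain M where "set_mset M \<subseteq> P" "derivable C (M, {#})"
    using assms unfolding entails_def by blast
  moreover from this(2) have "derivable C (M, {#A#})"
    by (intro derivable_LJ[OF LJ.WkR[of M A]]) simp
  ultimately show ?thesis unfolding entails_def by auto
qed

lemma entails_andR:
  assumes "entails C P {#A#}" "entails C P {#B#}"
  shows "entails C P {#And A B#}"
proof -
  obtain M N where M: "set_mset M \<subseteq> P" "derivable C (M, {#A#})"
    and N: "set_mset N \<subseteq> P" "derivable C (N, {#B#})"
    using assms unfolding entails_def by blast
  have "derivable C (N + M, {#A#})" using M(2) by (auto intro: derivable_weaken)
  moreover have "derivable C (N + M, {#B#})"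
    using derivable_weaken[OF N(2), of M] by (simp add: add.commute)
  ultimately have "derivable C (N + M, {#And A B#})"
    by (intro derivable_LJ[OF LJ.AndR[of "N + M" A B]]) auto
  then show ?thesis unfolding entails_def using M(1) N(1) by (auto intro!: exI[of _ "N + M"])
qed

lemma entails_orR1:
  assumes "entails C P {#A#}"
  shows "entails C P {#Or A B#}"
proof -
  obtain M where "set_mset M \<subseteq> P" "derivable C (M, {#A#})"
    using assms unfolding entails_def by blast
  moreover from this(2) have "derivable C (M, {#Or A B#})"
    by (intro derivable_LJ[OF LJ.OrR1[of M A]]) simp
  ultimately show ?thesis unfolding entails_def by auto
qed

lemma entails_orR2:
  assumes "entails C P {#B#}"
  shows "entails C P {#Or A B#}"
proof -
  obtain M where "set_mset M \<subseteq> P" "derivable C (M, {#B#})"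
    using assms unfolding entails_def by blast
  moreover from this(2) have "derivable C (M, {#Or A B#})"
    by (intro derivable_LJ[OF LJ.OrR2[of M B]]) simp
  ultimately show ?thesis unfolding entails_def by auto
qed

lemma entails_orL:
  assumes "entails C P {#Or A B#}" "entails C (insert A P) \<Delta>" "entails C (insert B P) \<Delta>"
  shows "entails C P \<Delta>"
proof (rule entails_cut[OF assms(1)])
  from assms(2) have size: "size \<Delta> \<le> 1" by (rule entails_size)
  obtain M where M: "set_mset M \<subseteq> P" "derivable C (add_mset A M, \<Delta>)"
    using assms(2) by (rule entails_insertE)
  obtain N where N: "set_mset N \<subseteq> P" "derivable C (add_mset B N, \<Delta>)"
    using assms(3) by (rule entails_insertE)
  have "derivable C (add_mset A (N + M), \<Delta>)" "derivable C (add_mset B (N + M), \<Delta>)"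
    using derivable_weaken[OF N(2) size, of M] derivable_weaken[OF M(2) size, of N]
    by (simp_all add: add.commute)
  then have "derivable C (add_mset (Or A B) (N + M), \<Delta>)"
    by (intro derivable_LJ[OF LJ.OrL[OF size, of A "N + M" B]]) auto
  then show "entails C (insert (Or A B) P) \<Delta>"
    unfolding entails_def using M(1) N(1) size by (auto intro!: exI[of _ "add_mset (Or A B) (N + M)"])
qed

lemma entails_impR:
  assumes "entails C (insert A P) {#B#}"
  shows "entails C P {#Imp A B#}"
proof -
  obtain M where M: "set_mset M \<subseteq> P" "derivable C (add_mset A M, {#B#})"
    using assms by (rule entails_insertE)
  then have "derivable C (M, {#Imp A B#})"
    by (intro derivable_LJ[OF LJ.ImpR[of A M B]]) auto
  with M(1) show ?thesis unfolding entails_def by auto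
qed

lemma entails_impL:
  assumes "entails C P {#Imp A B#}" "entails C P {#A#}"
  shows "entails C P {#B#}"
proof (rule entails_cut[OF assms(1)])
  obtain M where M: "set_mset M \<subseteq> P" "derivable C (M, {#A#})"
    using assms(2) unfolding entails_def by blast
  have "derivable C (add_mset B M, {#B#})"
    by (rule derivable_LJ[OF LJ.Ax]) simp
  then have "derivable C (add_mset (Imp A B) M, {#B#})"
    using M(2) by (intro derivable_LJ[OF LJ.ImpL[of "{#B#}" M A B]]) auto
  then show "entails C (insert (Imp A B) P) {#B#}"
    unfolding entails_def using M(1) by (auto intro!: exI[of _ "add_mset (Imp A B) M"])
qed

lemma entails_box:
  assumes "entails C P {#A#}"
  shows "entails C (Box ` P) {#Box A#}"
proof -
  obtain M where M: "set_mset M \<subseteq> P" "derivable C (M, {#A#})"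
    using assms unfolding entails_def by blast
  then have "derivable C (image_mset Box M, {#Box A#})"
    by (intro derivable_rule[OF CK_plus.CK_rule[OF CK.K_Box[of M A]]]) auto
  with M(1) show ?thesis unfolding entails_def by (intro conjI exI[of _ "image_mset Box M"]) auto
qed

lemma entails_dia:
  assumes "entails C (insert A P) {#B#}"
  shows "entails C (insert (Dia A) (Box ` P)) {#Dia B#}"
proof -
  obtain M where M: "set_mset M \<subseteq> P" "derivable C (add_mset A M, {#B#})"
    using assms by (rule entails_insertE)
  then have "derivable C (add_mset (Dia A) (image_mset Box M), {#Dia B#})"
    by (intro derivable_rule[OF CK_plus.CK_rule[OF CK.K_Dia[of A M B]]]) auto
  with M(1) show ?thesis
    unfolding entails_def by (intro conjI exI[of _ "add_mset (Dia A) (image_mset Box M)"]) auto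
qed

lemma entails_axiom: "A \<in> C \<Longrightarrow> entails C P {#fm_subst f A#}"
  unfolding entails_def using derivable_rule[OF CK_plus.Axiom[of A C f]]
  by (auto intro!: exI[of _ "{#}"])


section \<open>The Horn formulas of a proof\<close>

abbreviation angled :: "form \<Rightarrow> form_plus" where
  "angled A \<equiv> Atom (Angled A)"

fun curried :: "form list \<Rightarrow> form \<Rightarrow> form_plus" where
  "curried [] F = angled F"
| "curried (G # Gs) F = Imp (angled G) (curried Gs F)"

text \<open>Conjunctions occur in both directions; disjunctions and diamonds are only introduced, as
  they are needed for basic formulas, and implications and boxes are only decomposed.
  \<open>Top\<close> contributes its own atom because \<open>translate Top\<close> is that atom,
  which no rule of the calculus provides.\<close>

fun local_horn :: "form \<Rightarrow> form_plus list" where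
  "local_horn (Atom p) = []"
| "local_horn Top = [angled Top]"
| "local_horn Bot = []"
| "local_horn (And A B) =
     [Imp (angled A) (Imp (angled B) (angled (And A B))),
      Imp (angled (And A B)) (angled A), Imp (angled (And A B)) (angled B)]"
| "local_horn (Or A B) = [Imp (angled A) (angled (Or A B)), Imp (angled B) (angled (Or A B))]"
| "local_horn (Imp A B) = [Imp (angled (Imp A B)) (Imp (angled A) (angled B))]"
| "local_horn (Box A) = [Imp (angled (Box A)) (Box (angled A))]"
| "local_horn (Dia A) = [Imp (Dia (angled A)) (angled (Dia A))]"

fun subformulas :: "form \<Rightarrow> form list" where
  "subformulas (And A B) = And A B # subformulas A @ subformulas B"
| "subformulas (Or A B) = Or A B # subformulas A @ subformulas B"
| "subformulas (Imp A B) = Imp A B # subformulas A @ subformulas B"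
| "subformulas (Box A) = Box A # subformulas A"
| "subformulas (Dia A) = Dia A # subformulas A"
| "subformulas A = [A]"

primrec modal_depth :: "'a fm \<Rightarrow> nat" where
  "modal_depth (Atom p) = 0"
| "modal_depth Top = 0"
| "modal_depth Bot = 0"
| "modal_depth (And A B) = max (modal_depth A) (modal_depth B)"
| "modal_depth (Or A B) = max (modal_depth A) (modal_depth B)"
| "modal_depth (Imp A B) = max (modal_depth A) (modal_depth B)"
| "modal_depth (Box A) = Suc (modal_depth A)"
| "modal_depth (Dia A) = Suc (modal_depth A)"

definition horn_of :: "form \<Rightarrow> form_plus list" where
  "horn_of F = concat (map local_horn (subformulas F))"

lemma horn_of_simps [simp]:
  "horn_of (Atom p) = []"
  "horn_of Top = [angled Top]"
  "horn_of Bot = []"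
  "horn_of (And A B) = local_horn (And A B) @ horn_of A @ horn_of B"
  "horn_of (Or A B) = local_horn (Or A B) @ horn_of A @ horn_of B"
  "horn_of (Imp A B) = local_horn (Imp A B) @ horn_of A @ horn_of B"
  "horn_of (Box A) = local_horn (Box A) @ horn_of A"
  "horn_of (Dia A) = local_horn (Dia A) @ horn_of A"
  by (simp_all add: horn_of_def)

text \<open>Each \<open>Box\<close> and each \<open>Dia\<close> contributes a Horn formula of its
  own, so counting formulas can replace computing the modal depth.\<close>

lemma modal_depth_le_horn: "modal_depth F \<le> length (horn_of F)"
  by (induction F) auto

lemma modal_horn_Imp:
  "modal_horn B \<Longrightarrow> modal_horn (Imp (Atom p) B)"
  "modal_horn B \<Longrightarrow> modal_horn (Imp (Dia (Atom p)) B)"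
  using modal_horn.intros(4)[of "[(0, p)]" B] modal_horn.intros(4)[of "[(1, p)]" B] by auto

definition angled_horn :: "form_plus \<Rightarrow> bool" where
  "angled_horn A \<longleftrightarrow> modal_horn A \<and> atoms A \<subseteq> range Angled"

lemma angled_horn_curried: "angled_horn (curried Gs F)"
  unfolding angled_horn_def
  by (induction Gs) (auto intro: modal_horn.intros modal_horn_Imp)

lemma angled_horn_local: "A \<in> set (local_horn F) \<Longrightarrow> angled_horn A"
  unfolding angled_horn_def
  by (cases F) (auto intro!: modal_horn.intros(2,3) modal_horn_Imp)

lemma angled_horn_boxes: "angled_horn A \<Longrightarrow> angled_horn ((Box ^^ n) A)"
  unfolding angled_horn_def by (induction n) (auto intro: modal_horn.intros)

section \<open>Box prefixes and angled atoms\<close>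

definition boxes :: "nat \<Rightarrow> 'a fm set \<Rightarrow> 'a fm set" where
  "boxes n H = {(Box ^^ i) A |i A. i \<le> n \<and> A \<in> H}"

lemma subset_boxes: "H \<subseteq> boxes n H"
  unfolding boxes_def by (auto intro!: exI[of _ 0])

lemma Box_boxes: "Box ` boxes n H \<subseteq> boxes (Suc n) H"
proof -
  have "\<exists>j B. Box ((Box ^^ i) A) = (Box ^^ j) B \<and> j \<le> Suc n \<and> B \<in> H" if "i \<le> n" "A \<in> H" for i A
    using that by (intro exI[of _ "Suc i"] exI[of _ A]) auto
  then show ?thesis unfolding boxes_def by auto
qed

text \<open>A translation is the angled atom itself or a conjunction ending in it, except for
  \<open>Bot\<close>, from which everything follows.\<close>

lemma entails_translate_angled:
  assumes "entails C P {#translate F#}"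
  shows "entails C P {#angled F#}"
  using assms by (cases F) (auto intro: entails_andL2 entails_bot)

lemma entails_detach:
  "Imp A B \<in> P \<Longrightarrow> entails C P {#A#} \<Longrightarrow> entails C P {#B#}"
  by (rule entails_impL[OF entails_ax])

text \<open>The modal rules box every side premise, so a Horn formula used below \<open>i\<close>
  modalities must be present with \<open>i\<close> boxes. Since \<open>Box A\<close> does not yield
  \<open>A\<close> in general, all prefixes up to \<open>n\<close> are kept, and each passage below
  a modality costs one level.\<close>

lemma entails_under_box:
  assumes "entails C (insert A (boxes n H)) {#B#}" "entails C P {#Box A#}" "boxes (Suc n) H \<subseteq> P"
  shows "entails C P {#Box B#}"
proof (rule entails_cut[OF assms(2)])
  have "Box ` insert A (boxes n H) \<subseteq> insert (Box A) P"
    using Box_boxes[of n H] assms(3) by auto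
  with entails_box[OF assms(1)] show "entails C (insert (Box A) P) {#Box B#}"
    by (rule entails_mono)
qed

lemma entails_under_dia:
  assumes "entails C (insert A (boxes n H)) {#B#}" "entails C P {#Dia A#}" "boxes (Suc n) H \<subseteq> P"
  shows "entails C P {#Dia B#}"
proof (rule entails_cut[OF assms(2)])
  have "insert (Dia A) (Box ` boxes n H) \<subseteq> insert (Dia A) P"
    using Box_boxes[of n H] assms(3) by auto
  with entails_dia[OF assms(1)] show "entails C (insert (Dia A) P) {#Dia B#}"
    by (rule entails_mono)
qed

section \<open>Instances by translations versus translations of instances\<close>

lemma entails_trans:
  assumes "entails C (insert A Q) {#B#}" "Q \<subseteq> P" "entails C P {#A#}"
  shows "entails C P {#B#}"
  using assms entails_cut entails_mono insert_mono by metis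

text \<open>The angled atoms missing from the instance by translations are built from the inside out
  with the introduction formulas of \<open>local_horn\<close>.\<close>

lemma entails_basic_translate:
  assumes "basic A" "set (horn_of (fm_subst f A)) \<subseteq> H" "modal_depth (fm_subst f A) \<le> n"
  shows "entails C (insert (fm_subst (\<lambda>p. translate (f p)) A) (boxes n H))
    {#translate (fm_subst f A)#}"
  using assms
proof (induction A arbitrary: n rule: basic.induct)
  case (1 p)
  show ?case by (auto intro: entails_ax)
next
  case 2
  then show ?case using subset_boxes[of H n] by (auto intro: entails_ax)
next
  case 3
  show ?case by (auto intro: entails_ax)
next
  case (4 A B)
  let ?P = "insert (fm_subst (\<lambda>p. translate (f p)) (And A B)) (boxes n H)"
  have AB: "entails C ?P {#And (fm_subst (\<lambda>p. translate (f p)) A) (fm_subst (\<lambda>p. translate (f p)) B)#}"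
    by (auto intro: entails_ax)
  have A: "entails C ?P {#translate (fm_subst f A)#}"
    using 4 by (intro entails_trans[OF "4.IH"(1) _ entails_andL1[OF AB]]) auto
  have B: "entails C ?P {#translate (fm_subst f B)#}"
    using 4 by (intro entails_trans[OF "4.IH"(2) _ entails_andL2[OF AB]]) auto
  have "Imp (angled (fm_subst f A)) (Imp (angled (fm_subst f B)) (angled (fm_subst f (And A B)))) \<in> ?P"
    using "4.prems" subset_boxes[of H n] by auto
  from entails_impL[OF entails_detach[OF this]] A B
  have "entails C ?P {#angled (fm_subst f (And A B))#}" by (blast intro: entails_translate_angled)
  with A B show ?case by (auto intro: entails_andR)
next
  case (5 A B)
  let ?P = "insert (fm_subst (\<lambda>p. translate (f p)) (Or A B)) (boxes n H)"
  have AB: "entails C ?P {#Or (fm_subst (\<lambda>p. translate (f p)) A) (fm_subst (\<lambda>p. translate (f p)) B)#}"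
    by (auto intro: entails_ax)
  show ?case
  proof (rule entails_orL[OF AB])
    let ?Q = "insert (fm_subst (\<lambda>p. translate (f p)) A) ?P"
    have A: "entails C ?Q {#translate (fm_subst f A)#}"
      using 5 by (intro entails_mono[OF "5.IH"(1)]) auto
    have "Imp (angled (fm_subst f A)) (angled (fm_subst f (Or A B))) \<in> ?Q"
      using "5.prems" subset_boxes[of H n] by auto
    from entails_detach[OF this entails_translate_angled[OF A]] A
    show "entails C ?Q {#translate (fm_subst f (Or A B))#}"
      by (auto intro: entails_andR entails_orR1)
  next
    let ?Q = "insert (fm_subst (\<lambda>p. translate (f p)) B) ?P"
    have B: "entails C ?Q {#translate (fm_subst f B)#}"
      using 5 by (intro entails_mono[OF "5.IH"(2)]) auto
    have "Imp (angled (fm_subst f B)) (angled (fm_subst f (Or A B))) \<in> ?Q"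
      using "5.prems" subset_boxes[of H n] by auto
    from entails_detach[OF this entails_translate_angled[OF B]] B
    show "entails C ?Q {#translate (fm_subst f (Or A B))#}"
      by (auto intro: entails_andR entails_orR2)
  qed
next
  case (6 A)
  then obtain m where n: "n = Suc m" by (cases n) auto
  let ?P = "insert (fm_subst (\<lambda>p. translate (f p)) (Dia A)) (boxes n H)"
  have A: "entails C ?P {#Dia (translate (fm_subst f A))#}"
    using 6 n by (intro entails_under_dia[OF "6.IH"[of m]]) (auto intro: entails_ax)
  \<comment> \<open>The Horn formula for \<open>Dia\<close> has an angled atom below its diamond, so
    the translation is reduced to that atom inside the modality.\<close>
  have "entails C ?P {#Dia (angled (fm_subst f A))#}"
    by (rule entails_under_dia[OF _ A, where n = m and H = H])
      (auto simp: n intro: entails_translate_angled entails_ax)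
  moreover have "Imp (Dia (angled (fm_subst f A))) (angled (fm_subst f (Dia A))) \<in> ?P"
    using "6.prems" subset_boxes[of H n] by auto
  ultimately show ?case using A by (auto intro: entails_andR entails_detach)
qed

text \<open>In this direction angled conjuncts are only dropped, which the monotone connectives of
  basic formulas permit at every depth. Hence the side premises can be arbitrary.\<close>

lemma entails_basic_subst:
  assumes "basic A"
  shows "entails C (insert (translate (fm_subst f A)) P) {#fm_subst (\<lambda>p. translate (f p)) A#}"
  using assms
proof (induction A arbitrary: P rule: basic.induct)
  case (4 A B)
  let ?P = "insert (translate (fm_subst f (And A B))) P"
  have AB: "entails C ?P {#And (translate (fm_subst f A)) (translate (fm_subst f B))#}"
    by (auto intro: entails_ax entails_andL1)
  show ?case
    using entails_trans[OF "4.IH"(1) _ entails_andL1[OF AB]]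
      entails_trans[OF "4.IH"(2) _ entails_andL2[OF AB]]
    by (auto intro: entails_andR)
next
  case (5 A B)
  let ?P = "insert (translate (fm_subst f (Or A B))) P"
  have AB: "entails C ?P {#Or (translate (fm_subst f A)) (translate (fm_subst f B))#}"
    by (auto intro: entails_ax entails_andL1)
  show ?case
    by (rule entails_orL[OF AB])
      (use entails_orR1[OF "5.IH"(1)[of ?P]] entails_orR2[OF "5.IH"(2)[of ?P]] in auto)
next
  case (6 A)
  let ?P = "insert (translate (fm_subst f (Dia A))) P"
  have A: "entails C ?P {#Dia (translate (fm_subst f A))#}"
    by (auto intro: entails_ax entails_andL1)
  \<comment> \<open>Taking the induction hypothesis with no side premises leaves nothing to be boxed
    when \<open>Dia\<close> is applied.\<close>
  show ?case
    by (rule entails_cut[OF A]) (use entails_mono[OF entails_dia[OF "6.IH"[of "{}"]]] in auto)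
qed (auto intro: entails_ax entails_top)

text \<open>Again conjuncts are dropped, but the antecedent of an implication reverses the
  direction. Being basic, it is handled by \<open>entails_basic_translate\<close>, and this case is
  the source of the Horn formulas among the premises.\<close>

lemma entails_almost_positive:
  assumes "almost_positive A" "set (horn_of (fm_subst f A)) \<subseteq> H"
    "modal_depth (fm_subst f A) \<le> n"
  shows "entails C (insert (translate (fm_subst f A)) (boxes n H))
    {#fm_subst (\<lambda>p. translate (f p)) A#}"
  using assms
proof (induction A arbitrary: n rule: almost_positive.induct)
  case (1 A)
  then show ?case by (blast intro: entails_basic_subst)
next
  case (2 A B)
  let ?P = "insert (translate (fm_subst f (And A B))) (boxes n H)"
  have AB: "entails C ?P {#And (translate (fm_subst f A)) (translate (fm_subst f B))#}"
    by (auto intro: entails_ax entails_andL1)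
  show ?case
    using entails_trans[OF "2.IH"(1)[of n] _ entails_andL1[OF AB]]
      entails_trans[OF "2.IH"(2)[of n] _ entails_andL2[OF AB]] "2.prems"
    by (auto intro: entails_andR)
next
  case (3 A B)
  let ?P = "insert (translate (fm_subst f (Or A B))) (boxes n H)"
  have AB: "entails C ?P {#Or (translate (fm_subst f A)) (translate (fm_subst f B))#}"
    by (auto intro: entails_ax entails_andL1)
  show ?case
  proof (rule entails_orL[OF AB])
    have "entails C (insert (translate (fm_subst f A)) ?P) {#fm_subst (\<lambda>p. translate (f p)) A#}"
      by (rule entails_mono[OF "3.IH"(1)[of n]]) (use "3.prems" in auto)
    then show "entails C (insert (translate (fm_subst f A)) ?P)
        {#fm_subst (\<lambda>p. translate (f p)) (Or A B)#}"
      by (auto intro: entails_orR1)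
    have "entails C (insert (translate (fm_subst f B)) ?P) {#fm_subst (\<lambda>p. translate (f p)) B#}"
      by (rule entails_mono[OF "3.IH"(2)[of n]]) (use "3.prems" in auto)
    then show "entails C (insert (translate (fm_subst f B)) ?P)
        {#fm_subst (\<lambda>p. translate (f p)) (Or A B)#}"
      by (auto intro: entails_orR2)
  qed
next
  case (4 A)
  then obtain m where n: "n = Suc m" by (cases n) auto
  show ?case
    using 4 n by (auto intro!: entails_under_box[OF "4.IH"[of m]] intro: entails_ax entails_andL1)
next
  case (5 A)
  then obtain m where n: "n = Suc m" by (cases n) auto
  show ?case
    using 5 n by (auto intro!: entails_under_dia[OF "5.IH"[of m]] intro: entails_ax entails_andL1)
next
  case (6 A B)
  let ?P = "insert (translate (fm_subst f (Imp A B))) (boxes n H)"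
  let ?Q = "insert (fm_subst (\<lambda>p. translate (f p)) A) ?P"
  have AB: "entails C ?Q {#Imp (translate (fm_subst f A)) (translate (fm_subst f B))#}"
    by (auto intro: entails_ax entails_andL1)
  have "entails C ?Q {#translate (fm_subst f A)#}"
    by (rule entails_mono[OF entails_basic_translate[OF \<open>basic A\<close>, of f H n]])
      (use "6.prems" in auto)
  from entails_impL[OF AB this] have "entails C ?Q {#fm_subst (\<lambda>p. translate (f p)) B#}"
    using "6.prems" by (intro entails_trans[OF "6.IH"[of n]]) auto
  then show ?case by (auto intro: entails_impR)
qed

text \<open>The atom of the whole instance is decomposed alongside the formula, down to the basic
  parts, which \<open>entails_basic_translate\<close> completes. Antecedents are almost positive, so
  the reverse passage is available for them. The premises \<open>P\<close> are general because the
  implication case adds its antecedent to them.\<close>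

lemma entails_constructive:
  assumes "constructive A" "set (horn_of (fm_subst f A)) \<subseteq> H"
    "modal_depth (fm_subst f A) \<le> n" "boxes n H \<subseteq> P"
    "entails C P {#angled (fm_subst f A)#}" "entails C P {#fm_subst (\<lambda>p. translate (f p)) A#}"
  shows "entails C P {#translate (fm_subst f A)#}"
  using assms
proof (induction A arbitrary: n P rule: constructive.induct)
  case (1 A)
  then show ?case by (blast intro: entails_trans[OF entails_basic_translate])
next
  case (2 A B)
  have horn: "Imp (angled (fm_subst f (And A B))) (angled (fm_subst f A)) \<in> P"
    "Imp (angled (fm_subst f (And A B))) (angled (fm_subst f B)) \<in> P"
    using "2.prems" subset_boxes[of H n] by auto
  have AB: "entails C P {#And (fm_subst (\<lambda>p. translate (f p)) A) (fm_subst (\<lambda>p. translate (f p)) B)#}"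
    using "2.prems" by simp
  have "entails C P {#translate (fm_subst f A)#}"
    using "2.prems" entails_andL1[OF AB]
    by (intro "2.IH"(1)[of n P] entails_detach[OF horn(1)]) auto
  moreover have "entails C P {#translate (fm_subst f B)#}"
    using "2.prems" entails_andL2[OF AB]
    by (intro "2.IH"(2)[of n P] entails_detach[OF horn(2)]) auto
  ultimately show ?case using "2.prems"(4) by (auto intro: entails_andR)
next
  case (3 A)
  then obtain m where n: "n = Suc m" by (cases n) auto
  have horn: "Imp (angled (fm_subst f (Box A))) (Box (angled (fm_subst f A))) \<in> P"
    using "3.prems" subset_boxes[of H n] by auto
  let ?A = "fm_subst (\<lambda>p. translate (f p)) A"
  \<comment> \<open>Below the box \<open>m\<close> levels of prefixes remain. Both inserted formulas
    are available boxed outside: the second by assumption, the angled atom through the Horn formula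
    for \<open>Box\<close>.\<close>
  let ?Q = "insert (angled (fm_subst f A)) (insert ?A (boxes m H))"
  have "entails C ?Q {#translate (fm_subst f A)#}"
    using "3.prems" n by (intro "3.IH"[of m]) (auto intro: entails_ax)
  from entails_box[OF this]
  have "entails C (insert (Box (angled (fm_subst f A))) (insert (Box ?A) P))
      {#Box (translate (fm_subst f A))#}"
    using "3.prems"(3) Box_boxes[of m H] n by (elim entails_mono) auto
  moreover have "entails C (insert (Box ?A) P) {#Box (angled (fm_subst f A))#}"
    using entails_mono[OF entails_detach[OF horn "3.prems"(4)]] by blast
  moreover have "entails C P {#Box ?A#}" using "3.prems" by simp
  ultimately have "entails C P {#Box (translate (fm_subst f A))#}"
    by (blast intro: entails_cut)
  with "3.prems"(4) show ?case by (auto intro: entails_andR)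
next
  case (4 A B)
  let ?Q = "insert (translate (fm_subst f A)) P"
  have horn: "Imp (angled (fm_subst f (Imp A B))) (Imp (angled (fm_subst f A)) (angled (fm_subst f B))) \<in> ?Q"
    using "4.prems" subset_boxes[of H n] by auto
  have "entails C ?Q {#translate (fm_subst f A)#}" by (auto intro: entails_ax)
  then have angled_A: "entails C ?Q {#angled (fm_subst f A)#}" by (rule entails_translate_angled)
  have Q: "entails C ?Q {#angled (fm_subst f (Imp A B))#}"
    "entails C ?Q {#Imp (fm_subst (\<lambda>p. translate (f p)) A) (fm_subst (\<lambda>p. translate (f p)) B)#}"
    using "4.prems"(4,5) entails_mono[of C P _ ?Q] by auto
  have "entails C ?Q {#fm_subst (\<lambda>p. translate (f p)) A#}"
    by (rule entails_mono[OF entails_almost_positive[OF \<open>almost_positive A\<close>, of f H n]])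
      (use "4.prems" in auto)
  from entails_impL[OF Q(2) this] entails_impL[OF entails_detach[OF horn Q(1)] angled_A]
  have "entails C ?Q {#translate (fm_subst f B)#}"
    using "4.prems" by (intro "4.IH"[of n ?Q]) auto
  with "4.prems"(4) show ?case by (auto intro: entails_andR entails_impR)
qed

section \<open>Translation of a whole proof\<close>

lemma entails_uncurry:
  assumes "entails C P {#curried Gs F#}" "\<And>G. G \<in> set Gs \<Longrightarrow> entails C P {#angled G#}"
  shows "entails C P {#angled F#}"
  using assms by (induction Gs) (auto intro: entails_impL)

text \<open>An empty succedent has nothing to be strengthened and makes no demand.
  \<open>horn_of F\<close> is demanded at all other nodes, since proofs carry no rule annotations
  and any of them may be an axiom instance.\<close>

definition covers_sequent :: "form_plus set \<Rightarrow> nat sequent \<Rightarrow> bool" where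
  "covers_sequent H S \<longleftrightarrow> (\<forall>F. snd S = {#F#} \<longrightarrow>
     (\<exists>Gs. mset Gs = fst S \<and> curried Gs F \<in> H) \<and> set (horn_of F) \<subseteq> H)"

fun covers :: "form_plus set \<Rightarrow> nat proof_tree \<Rightarrow> bool" where
  "covers H (Proof_Tree S \<pi>s) \<longleftrightarrow> covers_sequent H S \<and> (\<forall>\<pi>\<in>set \<pi>s. covers H \<pi>)"

text \<open>A bound on the number of boxes needed: each succedent formula pays one level for a
  possible modal rule, and its modal depth pays for the modalities of a possible axiom instance. A
  sum over all nodes, rather than a maximum over branches, can be bounded by counting Horn
  formulas.\<close>

fun weight :: "nat proof_tree \<Rightarrow> nat" where
  "weight (Proof_Tree S \<pi>s) =
     (\<Sum>F\<in>#snd S. Suc (modal_depth F)) + sum_list (map weight \<pi>s)"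

text \<open>The translated antecedent formulas bring their own angled atoms, and these detach the
  curried Horn formula of the node.\<close>

lemma covers_sequent_angled:
  assumes "covers_sequent H (\<Gamma>, {#F#})"
  shows "entails C (translate ` set_mset \<Gamma> \<union> boxes n H) {#angled F#}"
proof -
  obtain Gs where Gs: "mset Gs = \<Gamma>" "curried Gs F \<in> H"
    using assms unfolding covers_sequent_def by auto
  show ?thesis
  proof (rule entails_uncurry)
    show "entails C (translate ` set_mset \<Gamma> \<union> boxes n H) {#curried Gs F#}"
      using Gs(2) subset_boxes[of H n] by (auto intro: entails_ax)
    show "entails C (translate ` set_mset \<Gamma> \<union> boxes n H) {#angled G#}" if "G \<in> set Gs" for G
      using that Gs(1) by (intro entails_translate_angled) (auto intro: entails_ax)
  qed
qed

text \<open>Left logical rules discard the angled conjunct of the principal formula; right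
  introductions of compound formulas add one, supplied by \<open>covers_sequent_angled\<close>. For
  \<open>TopR\<close> the Horn formula \<open>angled Top\<close> is the succedent itself. No rule
  here changes the modal level, so \<open>n\<close> stays fixed.\<close>

lemma entails_translate_LJ:
  fixes \<Gamma> :: "form multiset"
  assumes "LJ Ps S" "covers_sequent H S"
    and "\<And>\<Gamma>' \<Delta>'. (\<Gamma>', \<Delta>') \<in> set Ps \<Longrightarrow>
      entails C (translate ` set_mset \<Gamma>' \<union> boxes n H) (image_mset translate \<Delta>')"
  shows "entails C (translate ` set_mset (fst S) \<union> boxes n H) (image_mset translate (snd S))"
  using assms
proof (induction rule: LJ.induct)
  case (Ax A \<Gamma>)
  show ?case by (auto intro: entails_ax)
next
  case (BotL \<Delta> \<Gamma>)
  then show ?case by (auto intro: entails_bot entails_ax)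
next
  case (TopR \<Gamma>)
  then show ?case using subset_boxes[of H n] by (auto simp: covers_sequent_def intro: entails_ax)
next
  case (WkL \<Delta> \<Gamma> A)
  from WkL.prems(2)[of \<Gamma> \<Delta>] show ?case by (auto elim!: entails_mono)
next
  case (WkR \<Gamma> A)
  from WkR.prems(2)[of \<Gamma> "{#}"] show ?case by (auto intro: entails_weakR)
next
  case (ConL \<Delta> A \<Gamma>)
  then show ?case by simp
next
  case (Cut \<Delta> \<Gamma> A)
  from Cut.prems(2)[of \<Gamma> "{#A#}"] Cut.prems(2)[of "add_mset A \<Gamma>" \<Delta>] show ?case
    by (auto intro: entails_cut)
next
  case (AndL1 \<Delta> A \<Gamma> B)
  let ?P = "translate ` set_mset (add_mset (And A B) \<Gamma>) \<union> boxes n H"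
  show ?case unfolding fst_conv snd_conv
  proof (rule entails_cut)
    show "entails C ?P {#translate A#}"
      by (rule entails_andL1[of _ _ _ "translate B"], rule entails_andL1) (auto intro: entails_ax)
    show "entails C (insert (translate A) ?P) (image_mset translate \<Delta>)"
      using AndL1.prems(2)[of "add_mset A \<Gamma>" \<Delta>] by (auto elim!: entails_mono)
  qed
next
  case (AndL2 \<Delta> B \<Gamma> A)
  let ?P = "translate ` set_mset (add_mset (And A B) \<Gamma>) \<union> boxes n H"
  show ?case unfolding fst_conv snd_conv
  proof (rule entails_cut)
    show "entails C ?P {#translate B#}"
      by (rule entails_andL2[of _ _ "translate A"], rule entails_andL1) (auto intro: entails_ax)
    show "entails C (insert (translate B) ?P) (image_mset translate \<Delta>)"
      using AndL2.prems(2)[of "add_mset B \<Gamma>" \<Delta>] by (auto elim!: entails_mono)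
  qed
next
  case (AndR \<Gamma> A B)
  from AndR.prems(2)[of \<Gamma> "{#A#}"] AndR.prems(2)[of \<Gamma> "{#B#}"]
    covers_sequent_angled[OF AndR.prems(1)] show ?case
    by (auto intro: entails_andR)
next
  case (OrL \<Delta> A \<Gamma> B)
  let ?P = "translate ` set_mset (add_mset (Or A B) \<Gamma>) \<union> boxes n H"
  show ?case unfolding fst_conv snd_conv
  proof (rule entails_orL)
    show "entails C ?P {#Or (translate A) (translate B)#}"
      by (rule entails_andL1) (auto intro: entails_ax)
    show "entails C (insert (translate A) ?P) (image_mset translate \<Delta>)"
      using OrL.prems(2)[of "add_mset A \<Gamma>" \<Delta>] by (auto elim!: entails_mono)
    show "entails C (insert (translate B) ?P) (image_mset translate \<Delta>)"
      using OrL.prems(2)[of "add_mset B \<Gamma>" \<Delta>] by (auto elim!: entails_mono)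
  qed
next
  case (OrR1 \<Gamma> A B)
  from OrR1.prems(2)[of \<Gamma> "{#A#}"] covers_sequent_angled[OF OrR1.prems(1)] show ?case
    by (auto intro: entails_andR entails_orR1)
next
  case (OrR2 \<Gamma> B A)
  from OrR2.prems(2)[of \<Gamma> "{#B#}"] covers_sequent_angled[OF OrR2.prems(1)] show ?case
    by (auto intro: entails_andR entails_orR2)
next
  case (ImpL \<Delta> \<Gamma> A B)
  let ?P = "translate ` set_mset (add_mset (Imp A B) \<Gamma>) \<union> boxes n H"
  show ?case unfolding fst_conv snd_conv
  proof (rule entails_cut)
    have "entails C ?P {#Imp (translate A) (translate B)#}"
      by (rule entails_andL1) (auto intro: entails_ax)
    moreover have "entails C ?P {#translate A#}"
      using ImpL.prems(2)[of \<Gamma> "{#A#}"] by (auto elim!: entails_mono)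
    ultimately show "entails C ?P {#translate B#}" by (rule entails_impL)
    show "entails C (insert (translate B) ?P) (image_mset translate \<Delta>)"
      using ImpL.prems(2)[of "add_mset B \<Gamma>" \<Delta>] by (auto elim!: entails_mono)
  qed
next
  case (ImpR A \<Gamma> B)
  from ImpR.prems(2)[of "add_mset A \<Gamma>" "{#B#}"] covers_sequent_angled[OF ImpR.prems(1)]
  show ?case by (auto intro: entails_andR entails_impR)
qed

lemma entails_unboxed:
  assumes "Box A \<in># \<Gamma>"
  shows "entails C (translate ` set_mset \<Gamma> \<union> Q) {#Box (translate A)#}"
proof (rule entails_andL1)
  from assms have "translate (Box A) \<in> translate ` set_mset \<Gamma>" by (intro imageI) simp
  then show "entails C (translate ` set_mset \<Gamma> \<union> Q) {#And (Box (translate A)) (angled (Box A))#}"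
    by (auto intro: entails_ax)
qed

lemma entails_undiamonded:
  assumes "Dia A \<in># \<Gamma>"
  shows "entails C (translate ` set_mset \<Gamma> \<union> Q) {#Dia (translate A)#}"
proof (rule entails_andL1)
  from assms have "translate (Dia A) \<in> translate ` set_mset \<Gamma>" by (intro imageI) simp
  then show "entails C (translate ` set_mset \<Gamma> \<union> Q) {#And (Dia (translate A)) (angled (Dia A))#}"
    by (auto intro: entails_ax)
qed

lemma entails_translate_proof:
  assumes "\<And>A. A \<in> C \<Longrightarrow> constructive A"
    and "is_proof C \<pi>" "covers H \<pi>" "weight \<pi> \<le> n"
  shows "entails C (translate ` set_mset (fst (concl \<pi>)) \<union> boxes n H)
    (image_mset translate (snd (concl \<pi>)))"
  using assms
proof (induction C \<pi> arbitrary: n rule: is_proof.induct)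
  case (1 C S \<pi>s)
  have cov: "covers_sequent H S" using "1.prems" by simp
  \<comment> \<open>This is stated for every \<open>m\<close> above the weights of the premises,
    because the modal rules apply it with one level less than \<open>n\<close>.\<close>
  have IH: "entails C (translate ` set_mset \<Gamma>' \<union> boxes m H) (image_mset translate \<Delta>')"
    if in_set: "(\<Gamma>', \<Delta>') \<in> set (map concl \<pi>s)" and m: "sum_list (map weight \<pi>s) \<le> m" for \<Gamma>' \<Delta>' m
  proof -
    from in_set obtain \<pi> where \<pi>: "\<pi> \<in> set \<pi>s" "concl \<pi> = (\<Gamma>', \<Delta>')" by auto
    have "weight \<pi> \<le> sum_list (map weight \<pi>s)" using \<pi>(1) by (intro member_le_sum_list) auto
    with m have "weight \<pi> \<le> m" by simp
    with "1.IH"[OF \<pi>(1) "1.prems"(1), of m] "1.prems" \<pi> show ?thesis by auto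
  qed
  have weight: "sum_list (map weight \<pi>s) \<le> n" using "1.prems"(4) by simp
  from "1.prems"(2) have "CK_plus C (map concl \<pi>s) S" by simp
  then show ?case
  proof cases
    case CK_rule
    then show ?thesis
    proof cases
      case LJ_rule
      from entails_translate_LJ[OF LJ_rule cov IH] weight show ?thesis by simp
    next
      case (K_Box \<Gamma> A)
      \<comment> \<open>The succedent contributes at least one to the weight; this level is spent on
        the modal rule.\<close>
      from K_Box "1.prems"(4) obtain m where m: "n = Suc m" "sum_list (map weight \<pi>s) \<le> m"
        by (cases n) auto
      have "entails C (translate ` set_mset \<Gamma> \<union> boxes m H) {#translate A#}"
        using IH[of \<Gamma> "{#A#}" m] m K_Box by auto
      from entails_box[OF this]
      have "entails C (Box ` translate ` set_mset \<Gamma> \<union> Box ` boxes m H) {#Box (translate A)#}"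
        by (simp add: image_Un)
      \<comment> \<open>\<open>K_Box\<close> leaves boxed translations as premises, not translations
        of boxed formulas. The former are first conjuncts of the latter, and boxed Horn formulas lie
        one level up in \<open>boxes n H\<close>.\<close>
      moreover have "entails C (translate ` set_mset (image_mset Box \<Gamma>) \<union> boxes n H) {#B#}"
        if "B \<in> Box ` translate ` set_mset \<Gamma> \<union> Box ` boxes m H" for B
        using that
      proof
        assume "B \<in> Box ` translate ` set_mset \<Gamma>"
        then obtain D where D: "D \<in># \<Gamma>" "B = Box (translate D)" by blast
        then have "Box D \<in># image_mset Box \<Gamma>" by simp
        then show ?thesis unfolding D(2) by (rule entails_unboxed)
      next
        assume "B \<in> Box ` boxes m H"
        then show ?thesis using Box_boxes[of m H] m(1) by (blast intro: entails_ax)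
      qed
      ultimately have "entails C (translate ` set_mset (image_mset Box \<Gamma>) \<union> boxes n H)
          {#Box (translate A)#}"
        by (rule entails_cut_set)
      with covers_sequent_angled[OF cov[unfolded K_Box]] show ?thesis
        using K_Box by (auto intro: entails_andR)
    next
      case (K_Dia A \<Gamma> B)
      from K_Dia "1.prems"(4) obtain m where m: "n = Suc m" "sum_list (map weight \<pi>s) \<le> m"
        by (cases n) auto
      have "entails C (insert (translate A) (translate ` set_mset \<Gamma> \<union> boxes m H)) {#translate B#}"
        using IH[of "add_mset A \<Gamma>" "{#B#}" m] m K_Dia by auto
      from entails_dia[OF this]
      have "entails C (insert (Dia (translate A))
          (Box ` translate ` set_mset \<Gamma> \<union> Box ` boxes m H)) {#Dia (translate B)#}"
        by (simp add: image_Un)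
      moreover have "entails C (translate ` set_mset (add_mset (Dia A) (image_mset Box \<Gamma>)) \<union> boxes n H) {#D#}"
        if "D \<in> insert (Dia (translate A)) (Box ` translate ` set_mset \<Gamma> \<union> Box ` boxes m H)" for D
      proof -
        from that consider "D = Dia (translate A)" | E where "E \<in># \<Gamma>" "D = Box (translate E)"
          | "D \<in> Box ` boxes m H" by blast
        then show ?thesis
        proof cases
          case 1
          show ?thesis unfolding 1 by (rule entails_undiamonded) simp
        next
          case 2
          then have "Box E \<in># add_mset (Dia A) (image_mset Box \<Gamma>)" by simp
          then show ?thesis unfolding 2(2) by (rule entails_unboxed)
        next
          case 3
          then show ?thesis using Box_boxes[of m H] m(1) by (blast intro: entails_ax)
        qed
      qed
      ultimately have "entails C (translate ` set_mset (add_mset (Dia A) (image_mset Box \<Gamma>)) \<union> boxes n H)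
          {#Dia (translate B)#}"
        by (rule entails_cut_set)
      with covers_sequent_angled[OF cov[unfolded K_Dia]] show ?thesis
        using K_Dia by (auto intro: entails_andR)
    qed
  next
    case (Axiom A f)
    let ?P = "translate ` set_mset {#} \<union> boxes n H"
    have "entails C ?P {#translate (fm_subst f A)#}"
    proof (rule entails_constructive)
      show "constructive A" using "1.prems"(1) Axiom by blast
      show "set (horn_of (fm_subst f A)) \<subseteq> H" using cov Axiom by (auto simp: covers_sequent_def)
      show "modal_depth (fm_subst f A) \<le> n" using "1.prems"(4) Axiom by simp
      show "entails C ?P {#angled (fm_subst f A)#}"
        using covers_sequent_angled[OF cov[unfolded Axiom]] by simp
      show "entails C ?P {#fm_subst (\<lambda>p. translate (f p)) A#}"
        using Axiom by (blast intro: entails_axiom)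
    qed simp
    then show ?thesis using Axiom by simp
  qed
qed


section \<open>List processing in polynomial time\<close>

text \<open>If the growth caused by a step does not depend on the recursive result \<open>u\<close>,
  it can be read off at \<open>u = Leaf\<close>, where the polynomial running time of
  \<open>g\<close> already bounds it.\<close>

lemma poly_time_list_context:
  assumes "poly_time b"
    and g: "poly_time (\<lambda>d. g (head (head d)) (tail (head d)) (tail d))"
    and "\<And>a. f Leaf a = b a"
    and "\<And>y x a. f (Fork y x) a = g (Fork y x) a (f x a)"
    and size: "\<And>x a u. dsize (g x a u) \<le> dsize u + dsize (g x a Leaf)"
  shows "poly_time2 f"
proof -
  have "poly_time (\<lambda>d. Fork d Leaf)" by (intro poly_time_intros)
  from poly_time_comp[OF g this] have "poly_time (\<lambda>d. g (head d) (tail d) Leaf)" by simp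
  then obtain r where r: "poly_bound r" "\<And>d. dsize (g (head d) (tail d) Leaf) \<le> r (dsize d)"
    using poly_time_dsize by blast
  show ?thesis
  proof (rule poly_time_list_recursion[OF assms(1) g assms(3,4)])
    show "poly_bound (\<lambda>n. r (n + 1))"
      by (intro poly_bound_comp[OF r(1)] poly_bound_intros)
    show "dsize (g x a u) \<le> dsize u + r (dsize x + dsize a + 1)" for x a u
      using size[of x a u] r(2)[of "Fork x a"] by simp
  qed
qed

primrec append_d :: "data \<Rightarrow> data \<Rightarrow> data" where
  "append_d Leaf y = y"
| "append_d (Fork e x) y = Fork e (append_d x y)"

lemma append_d_list: "append_d (data_of_list xs) (data_of_list ys) = data_of_list (xs @ ys)"
  by (induction xs) auto

lemma dsize_append_d: "Suc (dsize (append_d x y)) = dsize x + dsize y"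
  by (induction x) auto

lemma dsize_append_d_le:
  "dsize (append_d x y) \<le> dsize x + dsize y" "dsize (append_d x Leaf) = dsize x"
  using dsize_append_d[of x y] dsize_append_d[of x Leaf] by auto

lemma poly_time_append_d: "poly_time2 append_d"
  by (rule poly_time_list_context[where b = "\<lambda>a. a" and g = "\<lambda>x a u. Fork (head x) u"])
    (auto intro!: poly_time_intros)

primrec flatmap_d :: "(data \<Rightarrow> data \<Rightarrow> data) \<Rightarrow> data \<Rightarrow> data \<Rightarrow> data" where
  "flatmap_d g Leaf a = Leaf"
| "flatmap_d g (Fork e x) a = append_d (g e a) (flatmap_d g x a)"

lemma poly_time_flatmap_d:
  assumes "poly_time2 g"
  shows "poly_time2 (flatmap_d g)"
proof (rule poly_time_list_context[where b = "\<lambda>a. Leaf" and g = "\<lambda>x a u. append_d (g (head x) a) u"])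
  show "poly_time (\<lambda>d. append_d (g (head (head (head d))) (tail (head d))) (tail d))"
    by (intro poly_time_intros poly_time_comp2[OF poly_time_append_d] poly_time_comp2[OF assms])
  show "dsize (append_d (g (head x) a) u) \<le> dsize u + dsize (append_d (g (head x) a) Leaf)" for x a u
    using dsize_append_d_le[of "g (head x) a"] by (simp add: add.commute)
qed (auto intro!: poly_time_intros)

primrec rev_d :: "data \<Rightarrow> data" where
  "rev_d Leaf = Leaf"
| "rev_d (Fork e x) = append_d (rev_d x) (Fork e Leaf)"

lemma rev_d_list: "rev_d (data_of_list xs) = data_of_list (rev xs)"
  by (induction xs) (auto simp flip: append_d_list)

lemma poly_time_rev_d: "poly_time rev_d"
proof -
  have "poly_time2 (\<lambda>x a. rev_d x)"
  proof (rule poly_time_list_context[where b = "\<lambda>a. Leaf"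
        and g = "\<lambda>x a u. append_d u (Fork (head x) Leaf)"])
    show "poly_time (\<lambda>d. append_d (tail d) (Fork (head (head (head d))) Leaf))"
      by (intro poly_time_intros poly_time_comp2[OF poly_time_append_d])
    show "dsize (append_d u (Fork (head x) Leaf))
        \<le> dsize u + dsize (append_d Leaf (Fork (head x) Leaf))" for x u
      using dsize_append_d_le(1)[of u "Fork (head x) Leaf"] by simp
  qed (auto intro!: poly_time_intros)
  from poly_time_comp2[OF this poly_time_id poly_time_id] show ?thesis .
qed

text \<open>The first argument is a unary counter.\<close>

primrec drop_d :: "data \<Rightarrow> data \<Rightarrow> data" where
  "drop_d Leaf y = y"
| "drop_d (Fork e x) y = tail (drop_d x y)"

lemma tail_data_of_list: "tail (data_of_list xs) = data_of_list (tl xs)"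
  by (cases xs) auto

lemma drop_d_list: "drop_d (data_of_list xs) (data_of_list ys) = data_of_list (drop (length xs) ys)"
  by (induction xs) (auto simp: tail_data_of_list tl_drop drop_Suc)

lemma poly_time_drop_d: "poly_time2 drop_d"
  by (rule poly_time_list_context[where b = "\<lambda>a. a" and g = "\<lambda>x a u. tail u"])
    (auto intro!: poly_time_intros intro: le_SucI dsize_tail_le)

text \<open>The suffixes of a list have all lengths from 0 up to its own, so they serve as the unary
  counters for the box prefixes.\<close>

primrec suffixes_d :: "data \<Rightarrow> data" where
  "suffixes_d Leaf = Fork Leaf Leaf"
| "suffixes_d (Fork e x) = Fork (Fork e x) (suffixes_d x)"

fun suffixes :: "'x list \<Rightarrow> 'x list list" where
  "suffixes [] = [[]]"
| "suffixes (x # xs) = (x # xs) # suffixes xs"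

lemma suffixes_d_list: "suffixes_d (data_of_list xs) = data_of_list (map data_of_list (suffixes xs))"
  by (induction xs) auto

lemma length_suffixes: "length ` set (suffixes xs) = {..length xs}"
  by (induction xs) (auto simp: atMost_Suc)

lemma poly_time_suffixes_d: "poly_time suffixes_d"
proof -
  have "poly_time2 (\<lambda>x a. suffixes_d x)"
    by (rule poly_time_list_context[where b = "\<lambda>a. Fork Leaf Leaf" and g = "\<lambda>x a u. Fork x u"])
      (auto intro!: poly_time_intros)
  from poly_time_comp2[OF this poly_time_id poly_time_id] show ?thesis .
qed

text \<open>A preorder listing with abstract children \<open>h1\<close> and \<open>h2\<close>. The
  size test secures termination for arbitrary children; under the hypothesis \<open>dec\<close> of
  \<open>poly_time_collect_d\<close> the recursion stops exactly at \<open>Leaf\<close>.\<close>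

function collect_d :: "(data \<Rightarrow> data) \<Rightarrow> (data \<Rightarrow> data) \<Rightarrow> (data \<Rightarrow> data) \<Rightarrow> data \<Rightarrow> data" where
  "collect_d k h1 h2 x =
     (if x = Leaf \<or> dsize x \<le> dsize (h1 x) + dsize (h2 x) then Leaf
      else Fork (k x) (append_d (collect_d k h1 h2 (h1 x)) (collect_d k h1 h2 (h2 x))))"
  by pat_completeness auto
termination by (relation "measure (\<lambda>(k, h1, h2, x). dsize x)") auto

declare collect_d.simps [simp del]

lemma poly_time_collect_d:
  assumes "poly_time k" "poly_time h1" "poly_time h2"
    and dec: "\<And>x. x \<noteq> Leaf \<Longrightarrow> dsize (h1 x) + dsize (h2 x) < dsize x"
  shows "poly_time (collect_d k h1 h2)"
proof -
  obtain r where r: "poly_bound r" "\<And>d. dsize (k d) \<le> r (dsize d)"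
    using poly_time_dsize[OF assms(1)] by blast
  have "poly_time2 (\<lambda>x a. collect_d k h1 h2 x)"
  proof (rule poly_time_tree_recursion[where b = "\<lambda>a. Leaf" and ?h1.0 = h1 and ?h2.0 = h2
        and g = "\<lambda>x a u v. Fork (k x) (append_d u v)" and r = "\<lambda>n. r n + 1"])
    show "poly_time (\<lambda>d. Fork (k (head (head d))) (append_d (head (tail d)) (tail (tail d))))"
      by (intro poly_time_intros poly_time_comp2[OF poly_time_append_d] poly_time_comp[OF assms(1)])
    show "poly_bound (\<lambda>n. r n + 1)" by (intro poly_bound_intros r(1))
    show "dsize (Fork (k x) (append_d u v)) \<le> dsize u + dsize v + (r (dsize x + dsize a) + 1)" for x a u v
      using r(2)[of x] dsize_append_d_le(1)[of u v]
        poly_bound_mono[OF r(1), of "dsize x" "dsize x + dsize a"] by simp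
    show "collect_d k h1 h2 Leaf = Leaf" by (simp add: collect_d.simps)
    show "collect_d k h1 h2 x = Fork (k x) (append_d (collect_d k h1 h2 (h1 x)) (collect_d k h1 h2 (h2 x)))"
      if "x \<noteq> Leaf" for x
      using dec[OF that] that by (simp add: collect_d.simps[of k h1 h2 x])
  qed (use assms dec in \<open>auto intro!: poly_time_intros\<close>)
  from poly_time_comp2[OF this poly_time_id poly_time_id] show ?thesis .
qed


section \<open>Formulas and proofs as trees\<close>

definition top_d :: data where "top_d = Fork (data_of_nat 1) Leaf"
definition and_d :: "data \<Rightarrow> data \<Rightarrow> data" where "and_d A B = Fork (data_of_nat 3) (Fork A B)"
definition or_d :: "data \<Rightarrow> data \<Rightarrow> data" where "or_d A B = Fork (data_of_nat 4) (Fork A B)"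
definition imp_d :: "data \<Rightarrow> data \<Rightarrow> data" where "imp_d A B = Fork (data_of_nat 5) (Fork A B)"
definition box_d :: "data \<Rightarrow> data" where "box_d A = Fork (data_of_nat 6) A"
definition dia_d :: "data \<Rightarrow> data" where "dia_d A = Fork (data_of_nat 7) A"
definition angled_d :: "data \<Rightarrow> data" where
  "angled_d A = Fork (data_of_nat 0) (Fork (data_of_nat 1) A)"
definition node_d :: "data \<Rightarrow> data \<Rightarrow> data \<Rightarrow> data" where
  "node_d \<Gamma> A ds = Fork (Fork \<Gamma> (Fork A Leaf)) ds"
definition succedent_d :: "data \<Rightarrow> data" where "succedent_d d = head (tail (head d))"

lemmas syntax_d_defs = top_d_def and_d_def or_d_def imp_d_def box_d_def dia_d_def angled_d_def
  node_d_def succedent_d_def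

lemma data_of_form_simps:
  "data_of_form Top = top_d"
  "data_of_form (And A B) = and_d (data_of_form A) (data_of_form B)"
  "data_of_form (Or A B) = or_d (data_of_form A) (data_of_form B)"
  "data_of_form (Imp A B) = imp_d (data_of_form A) (data_of_form B)"
  "data_of_form (Box A) = box_d (data_of_form A)"
  "data_of_form (Dia A) = dia_d (data_of_form A)"
  by (simp_all add: data_of_form_def syntax_d_defs)

lemma data_of_form_plus_simps:
  "data_of_form_plus (angled A) = angled_d (data_of_form A)"
  "data_of_form_plus (Imp P Q) = imp_d (data_of_form_plus P) (data_of_form_plus Q)"
  "data_of_form_plus (Box P) = box_d (data_of_form_plus P)"
  "data_of_form_plus (Dia P) = dia_d (data_of_form_plus P)"
  by (simp_all add: data_of_form_plus_def syntax_d_defs)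

lemma std_subst_simps [simp]:
  "std_subst (angled A) = A"
  "std_subst (Imp P Q) = Imp (std_subst P) (std_subst Q)"
  "std_subst (Box P) = Box (std_subst P)"
  "std_subst (Dia P) = Dia (std_subst P)"
  by (simp_all add: std_subst_def)

definition certifies :: "form set \<Rightarrow> data \<Rightarrow> nat sequent \<Rightarrow> bool" where
  "certifies C d S \<longleftrightarrow> (\<exists>\<sigma>. represents_proof d \<sigma> \<and> proof_of C \<sigma> S)"

text \<open>The new node lists its antecedent in the order \<open>As\<close>, while the premises may
  list theirs in any order, since rules act on multisets. So no code ever has to be reordered to
  make a rule applicable.\<close>

lemma certifies_rule:
  assumes "CK_plus C Ss (mset As, {#F#})" "list_all2 (certifies C) ds Ss"
  shows "certifies C (node_d (data_of_list (map data_of_form As)) (data_of_form F) (data_of_list ds))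
    (mset As, {#F#})"
proof -
  have "\<exists>\<pi>s. list_all2 represents_proof ds \<pi>s \<and> list_all2 (proof_of C) \<pi>s Ss"
    using assms(2)
  proof (induction ds Ss rule: list_all2_induct)
    case (Cons d ds S Ss)
    then obtain \<pi> \<pi>s where "list_all2 represents_proof (d # ds) (\<pi> # \<pi>s)"
      "list_all2 (proof_of C) (\<pi> # \<pi>s) (S # Ss)"
      unfolding certifies_def by auto
    then show ?case by blast
  qed simp
  then obtain \<pi>s where \<pi>s: "list_all2 represents_proof ds \<pi>s" "list_all2 (proof_of C) \<pi>s Ss"
    by blast
  have "map concl \<pi>s = Ss" "\<forall>\<pi>\<in>set \<pi>s. is_proof C \<pi>"
    using \<pi>s(2) by (induction \<pi>s Ss rule: list_all2_induct) (auto simp: proof_of_def)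
  then have "proof_of C (Proof_Tree (mset As, {#F#}) \<pi>s) (mset As, {#F#})"
    using assms(1) by (simp add: proof_of_def)
  moreover have "represents_mset data_of_form (data_of_list (map data_of_form As)) (mset As)"
    "represents_mset data_of_form (data_of_list [data_of_form F]) {#F#}"
    unfolding represents_mset_def by (auto intro: exI[of _ As] exI[of _ "[F]"])
  then have "represents_proof (node_d (data_of_list (map data_of_form As)) (data_of_form F) (data_of_list ds))
      (Proof_Tree (mset As, {#F#}) \<pi>s)"
    unfolding node_d_def using represents_proof.intros[OF _ _ \<pi>s(1)] by simp
  ultimately show ?thesis unfolding certifies_def by blast
qed

lemma certifies_CK:
  assumes "CK Ss (mset As, {#F#})" "list_all2 (certifies C) ds Ss"
  shows "certifies C (node_d (data_of_list (map data_of_form As)) (data_of_form F) (data_of_list ds))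
    (mset As, {#F#})"
  using assms by (intro certifies_rule CK_plus.CK_rule)

lemma certifies_LJ:
  assumes "LJ Ss (mset As, {#F#})" "list_all2 (certifies C) ds Ss"
  shows "certifies C (node_d (data_of_list (map data_of_form As)) (data_of_form F) (data_of_list ds))
    (mset As, {#F#})"
  using assms by (intro certifies_CK CK.LJ_rule)

text \<open>A singleton has only one listing, so the succedent can be read off any code of the
  proof.\<close>

lemma succedent_d_certified:
  assumes "certifies C d (\<Gamma>, {#F#})"
  shows "succedent_d d = data_of_form F"
proof -
  from assms obtain \<sigma> where "represents_proof d \<sigma>" "concl \<sigma> = (\<Gamma>, {#F#})"
    unfolding certifies_def proof_of_def by blast
  then show ?thesis
    by (cases rule: represents_proof.cases) (auto simp: represents_mset_def succedent_d_def)
qed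

lemma certifies_Ax:
  "F \<in> set As \<Longrightarrow>
    certifies C (node_d (data_of_list (map data_of_form As)) (data_of_form F) Leaf) (mset As, {#F#})"
  using certifies_LJ[of "[]" As F C "[]"] LJ.Ax[of F "mset As - {#F#}"] by simp

lemma certifies_Imp:
  assumes "certifies C d ({#A#}, {#B#})"
  shows "certifies C (node_d Leaf (imp_d (data_of_form A) (data_of_form B)) (Fork d Leaf))
    ({#}, {#Imp A B#})"
  using certifies_LJ[of "[({#A#}, {#B#})]" "[]" "Imp A B" C "[d]"] assms
  by (simp add: LJ.ImpR data_of_form_simps)

text \<open>For implications and modalities the standard substitution turns the local Horn formula
  into an implication from a formula to itself, and this is its proof.\<close>

definition identity_d :: "data \<Rightarrow> data" where
  "identity_d A = node_d Leaf (imp_d A A) (Fork (node_d (Fork A Leaf) A Leaf) Leaf)"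

lemma certifies_identity: "certifies C (identity_d (data_of_form A)) ({#}, {#Imp A A#})"
  unfolding identity_d_def using certifies_Ax[of A "[A]" C] by (intro certifies_Imp) simp


section \<open>The algorithm\<close>

text \<open>The algorithm carries each Horn formula together with a proof of its standard
  substitution, so both outputs are obtained from a single list.\<close>

definition item :: "form set \<Rightarrow> data \<Rightarrow> form_plus \<Rightarrow> bool" where
  "item C e h \<longleftrightarrow> (\<exists>d. e = Fork (data_of_form_plus h) d \<and>
     certifies C d ({#}, {#std_subst h#}) \<and> angled_horn h)"

definition items :: "form set \<Rightarrow> data \<Rightarrow> form_plus list \<Rightarrow> bool" where
  "items C d hs \<longleftrightarrow> (\<exists>es. d = data_of_list es \<and> list_all2 (item C) es hs)"

lemma items_Nil: "items C Leaf []"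
  unfolding items_def by (auto intro: exI[of _ "[]"])

lemma items_Cons: "item C e h \<Longrightarrow> items C d hs \<Longrightarrow> items C (Fork e d) (h # hs)"
  unfolding items_def by (metis data_of_list.simps(2) list_all2_Cons)

lemma items_append: "items C d hs \<Longrightarrow> items C d' hs' \<Longrightarrow> items C (append_d d d') (hs @ hs')"
  unfolding items_def by (metis append_d_list list_all2_appendI)

lemma items_flatmap:
  "(\<And>x. x \<in> set xs \<Longrightarrow> items C (g (f x) a) (h x)) \<Longrightarrow>
    items C (flatmap_d g (data_of_list (map f xs)) a) (concat (map h xs))"
  by (induction xs) (auto intro: items_Nil items_append)

lemma items_flatmap_items:
  "list_all2 (item C) es hs \<Longrightarrow> (\<And>e h. item C e h \<Longrightarrow> items C (g e a) (k h)) \<Longrightarrow>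
    items C (flatmap_d g (data_of_list es) a) (concat (map k hs))"
  by (induction es hs rule: list_all2_induct) (auto intro: items_Nil items_append)

text \<open>Fixed proof patterns for pairing and the two projections, into which only the codes of
  the conjuncts and of the conjunction \<open>X\<close> are plugged.\<close>

definition local_and_d :: "data \<Rightarrow> data \<Rightarrow> data \<Rightarrow> data" where
  "local_and_d X A B =
     Fork (Fork (imp_d (angled_d A) (imp_d (angled_d B) (angled_d X)))
       (node_d Leaf (imp_d A (imp_d B X))
         (Fork (node_d (Fork A Leaf) (imp_d B X)
           (Fork (node_d (Fork B (Fork A Leaf)) X
             (Fork (node_d (Fork B (Fork A Leaf)) A Leaf)
               (Fork (node_d (Fork B (Fork A Leaf)) B Leaf) Leaf))) Leaf)) Leaf)))
     (Fork (Fork (imp_d (angled_d X) (angled_d A))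
       (node_d Leaf (imp_d X A)
         (Fork (node_d (Fork X Leaf) A (Fork (node_d (Fork A Leaf) A Leaf) Leaf)) Leaf)))
     (Fork (Fork (imp_d (angled_d X) (angled_d B))
       (node_d Leaf (imp_d X B)
         (Fork (node_d (Fork X Leaf) B (Fork (node_d (Fork B Leaf) B Leaf) Leaf)) Leaf)))
     Leaf))"

definition local_or_d :: "data \<Rightarrow> data \<Rightarrow> data \<Rightarrow> data" where
  "local_or_d X A B =
     Fork (Fork (imp_d (angled_d A) (angled_d X))
       (node_d Leaf (imp_d A X)
         (Fork (node_d (Fork A Leaf) X (Fork (node_d (Fork A Leaf) A Leaf) Leaf)) Leaf)))
     (Fork (Fork (imp_d (angled_d B) (angled_d X))
       (node_d Leaf (imp_d B X)
         (Fork (node_d (Fork B Leaf) X (Fork (node_d (Fork B Leaf) B Leaf) Leaf)) Leaf)))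
     Leaf)"

text \<open>The tests are on the connective tags of \<open>data_of_fm\<close>; tags 0 and 2, those
  of atoms and \<open>Bot\<close>, contribute nothing.\<close>

definition local_d :: "data \<Rightarrow> data" where
  "local_d X =
    (if head X = data_of_nat 1 then Fork (Fork (angled_d X) (node_d Leaf X Leaf)) Leaf
     else if head X = data_of_nat 3 then local_and_d X (head (tail X)) (tail (tail X))
     else if head X = data_of_nat 4 then local_or_d X (head (tail X)) (tail (tail X))
     else if head X = data_of_nat 5 then
       Fork (Fork (imp_d (angled_d X) (imp_d (angled_d (head (tail X))) (angled_d (tail (tail X)))))
         (identity_d X)) Leaf
     else if head X = data_of_nat 6 then
       Fork (Fork (imp_d (angled_d X) (box_d (angled_d (tail X)))) (identity_d X)) Leaf
     else if head X = data_of_nat 7 then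
       Fork (Fork (imp_d (dia_d (angled_d (tail X))) (angled_d X)) (identity_d X)) Leaf
     else Leaf)"

lemma poly_time_local_d: "poly_time local_d"
  unfolding local_d_def local_and_d_def local_or_d_def identity_d_def syntax_d_defs
  by (intro poly_time_intros)

lemma local_d_simps:
  "local_d (data_of_form (Atom p)) = Leaf"
  "local_d (data_of_form Top) = Fork (Fork (angled_d (data_of_form Top)) (node_d Leaf (data_of_form Top) Leaf)) Leaf"
  "local_d (data_of_form Bot) = Leaf"
  "local_d (data_of_form (And A B)) = local_and_d (data_of_form (And A B)) (data_of_form A) (data_of_form B)"
  "local_d (data_of_form (Or A B)) = local_or_d (data_of_form (Or A B)) (data_of_form A) (data_of_form B)"
  "local_d (data_of_form (Imp A B)) =
    Fork (Fork (imp_d (angled_d (data_of_form (Imp A B)))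
      (imp_d (angled_d (data_of_form A)) (angled_d (data_of_form B)))) (identity_d (data_of_form (Imp A B)))) Leaf"
  "local_d (data_of_form (Box A)) =
    Fork (Fork (imp_d (angled_d (data_of_form (Box A))) (box_d (angled_d (data_of_form A))))
      (identity_d (data_of_form (Box A)))) Leaf"
  "local_d (data_of_form (Dia A)) =
    Fork (Fork (imp_d (dia_d (angled_d (data_of_form A))) (angled_d (data_of_form (Dia A))))
      (identity_d (data_of_form (Dia A)))) Leaf"
  by (simp_all add: local_d_def data_of_form_def)

lemma items_local_and:
  "items C (local_and_d (data_of_form (And A B)) (data_of_form A) (data_of_form B)) (local_horn (And A B))"
proof -
  let ?A = "data_of_form A" and ?B = "data_of_form B" and ?X = "data_of_form (And A B)"
  have "certifies C (node_d (Fork ?B (Fork ?A Leaf)) ?A Leaf) ({#B, A#}, {#A#})"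
    "certifies C (node_d (Fork ?B (Fork ?A Leaf)) ?B Leaf) ({#B, A#}, {#B#})"
    using certifies_Ax[of A "[B, A]" C] certifies_Ax[of B "[B, A]" C] by simp_all
  then have "certifies C (node_d (Fork ?B (Fork ?A Leaf)) ?X
      (Fork (node_d (Fork ?B (Fork ?A Leaf)) ?A Leaf)
        (Fork (node_d (Fork ?B (Fork ?A Leaf)) ?B Leaf) Leaf))) ({#B, A#}, {#And A B#})" (is "certifies C ?d _")
    using certifies_LJ[of "[({#B, A#}, {#A#}), ({#B, A#}, {#B#})]" "[B, A]" "And A B" C "[_, _]"]
    by (simp add: LJ.AndR)
  then have "certifies C (node_d (Fork ?A Leaf) (imp_d ?B ?X) (Fork ?d Leaf)) ({#A#}, {#Imp B (And A B)#})"
    using certifies_LJ[of "[({#B, A#}, {#And A B#})]" "[A]" "Imp B (And A B)" C "[_]"]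
    by (simp add: LJ.ImpR data_of_form_simps)
  from certifies_Imp[OF this] have 1: "certifies C (node_d Leaf (imp_d ?A (imp_d ?B ?X))
      (Fork (node_d (Fork ?A Leaf) (imp_d ?B ?X) (Fork ?d Leaf)) Leaf)) ({#}, {#Imp A (Imp B (And A B))#})"
    by (simp add: data_of_form_simps)
  have "certifies C (node_d (Fork ?X Leaf) ?A (Fork (node_d (Fork ?A Leaf) ?A Leaf) Leaf)) ({#And A B#}, {#A#})"
    using certifies_LJ[of "[({#A#}, {#A#})]" "[And A B]" A C "[_]"] certifies_Ax[of A "[A]" C]
    by (simp add: LJ.AndL1)
  note 2 = certifies_Imp[OF this]
  have "certifies C (node_d (Fork ?X Leaf) ?B (Fork (node_d (Fork ?B Leaf) ?B Leaf) Leaf)) ({#And A B#}, {#B#})"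
    using certifies_LJ[of "[({#B#}, {#B#})]" "[And A B]" B C "[_]"] certifies_Ax[of B "[B]" C]
    by (simp add: LJ.AndL2)
  note 3 = certifies_Imp[OF this]
  show ?thesis
    unfolding local_and_d_def local_horn.simps
    using 1 2 3 angled_horn_local[of _ "And A B"]
    by (intro items_Cons items_Nil) (auto simp: item_def data_of_form_plus_simps)
qed

lemma items_local_or:
  "items C (local_or_d (data_of_form (Or A B)) (data_of_form A) (data_of_form B)) (local_horn (Or A B))"
proof -
  let ?A = "data_of_form A" and ?B = "data_of_form B" and ?X = "data_of_form (Or A B)"
  have "certifies C (node_d (Fork ?A Leaf) ?X (Fork (node_d (Fork ?A Leaf) ?A Leaf) Leaf)) ({#A#}, {#Or A B#})"
    using certifies_LJ[of "[({#A#}, {#A#})]" "[A]" "Or A B" C "[_]"] certifies_Ax[of A "[A]" C]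
    by (simp add: LJ.OrR1)
  note 1 = certifies_Imp[OF this]
  have "certifies C (node_d (Fork ?B Leaf) ?X (Fork (node_d (Fork ?B Leaf) ?B Leaf) Leaf)) ({#B#}, {#Or A B#})"
    using certifies_LJ[of "[({#B#}, {#B#})]" "[B]" "Or A B" C "[_]"] certifies_Ax[of B "[B]" C]
    by (simp add: LJ.OrR2)
  note 2 = certifies_Imp[OF this]
  show ?thesis
    unfolding local_or_d_def local_horn.simps
    using 1 2 angled_horn_local[of _ "Or A B"]
    by (intro items_Cons items_Nil) (auto simp: item_def data_of_form_plus_simps)
qed

lemma items_local: "items C (local_d (data_of_form F)) (local_horn F)"
proof -
  have top: "certifies C (node_d Leaf (data_of_form Top) Leaf) ({#}, {#Top#})"
    using certifies_LJ[of "[]" "[]" Top C "[]"] by (simp add: LJ.TopR)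
  show ?thesis
  proof (cases F)
    case And
    then show ?thesis using items_local_and by (simp only: local_d_simps)
  next
    case Or
    then show ?thesis using items_local_or by (simp only: local_d_simps)
  qed (use certifies_identity angled_horn_local[of _ F] top in
      \<open>auto simp: local_d_simps item_def data_of_form_plus_simps intro!: items_Nil items_Cons\<close>)
qed

section \<open>Listing the subformulas\<close>

definition binary_d :: "data \<Rightarrow> data \<Rightarrow> data \<Rightarrow> data \<Rightarrow> data" where
  "binary_d X a b c =
    (if head X = data_of_nat 3 then a else if head X = data_of_nat 4 then a
     else if head X = data_of_nat 5 then a
     else if head X = data_of_nat 6 then b else if head X = data_of_nat 7 then b else c)"

text \<open>The tag decides how many children a code has: two for a binary connective, one for a
  modality, none otherwise. \<open>Leaf\<close> marks a missing child.\<close>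

definition subformulas_d :: "data \<Rightarrow> data" where
  "subformulas_d = collect_d (\<lambda>X. X) (\<lambda>X. binary_d X (head (tail X)) (tail X) Leaf)
     (\<lambda>X. binary_d X (tail (tail X)) Leaf Leaf)"

lemma dsize_binary_d:
  assumes "X \<noteq> Leaf"
  shows "dsize (binary_d X (head (tail X)) (tail X) Leaf) + dsize (binary_d X (tail (tail X)) Leaf Leaf)
    < dsize X"
proof -
  from assms obtain t Y where X: "X = Fork t Y" by (cases X) auto
  \<comment> \<open>The additional one covers \<open>Y = Leaf\<close>, whose head and tail are again
    \<open>Leaf\<close>. It is compensated by the tag \<open>t\<close> and the node above
    it.\<close>
  have "dsize (head Y) + dsize (tail Y) \<le> dsize Y + 1" by (cases Y) auto
  then show ?thesis using dsize_pos[of t] dsize_pos[of Y] unfolding X binary_d_def by auto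
qed

lemma poly_time_subformulas_d: "poly_time subformulas_d"
  unfolding subformulas_d_def
proof (rule poly_time_collect_d[OF _ _ _ dsize_binary_d])
  show "poly_time (\<lambda>X. binary_d X (head (tail X)) (tail X) Leaf)"
    "poly_time (\<lambda>X. binary_d X (tail (tail X)) Leaf Leaf)"
    unfolding binary_d_def by (intro poly_time_intros)+
qed (auto intro: poly_time_id)

lemma subformulas_d_step:
  "X \<noteq> Leaf \<Longrightarrow> subformulas_d X = Fork X
    (append_d (subformulas_d (binary_d X (head (tail X)) (tail X) Leaf))
      (subformulas_d (binary_d X (tail (tail X)) Leaf Leaf)))"
  using dsize_binary_d[of X] unfolding subformulas_d_def by (subst collect_d.simps) simp

lemma subformulas_d_Leaf: "subformulas_d Leaf = Leaf"
  by (simp add: subformulas_d_def collect_d.simps)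

lemma subformulas_d_form:
  "subformulas_d (data_of_form F) = data_of_list (map data_of_form (subformulas F))"
proof (induction F)
  case (Atom p)
  then show ?case by (subst subformulas_d_step)
      (auto simp: data_of_form_def binary_d_def subformulas_d_Leaf)
next
  case Top
  then show ?case by (subst subformulas_d_step)
      (auto simp: data_of_form_def binary_d_def subformulas_d_Leaf)
next
  case Bot
  then show ?case by (subst subformulas_d_step)
      (auto simp: data_of_form_def binary_d_def subformulas_d_Leaf)
next
  case (And A B)
  then show ?case by (subst subformulas_d_step)
      (auto simp: data_of_form_simps syntax_d_defs binary_d_def append_d_list)
next
  case (Or A B)
  then show ?case by (subst subformulas_d_step)
      (auto simp: data_of_form_simps syntax_d_defs binary_d_def append_d_list)
next
  case (Imp A B)
  then show ?case by (subst subformulas_d_step)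
      (auto simp: data_of_form_simps syntax_d_defs binary_d_def append_d_list)
next
  case (Box A)
  then show ?case by (subst subformulas_d_step)
      (auto simp: data_of_form_simps syntax_d_defs binary_d_def subformulas_d_Leaf
        append_d_list[of _ "[]", simplified])
next
  case (Dia A)
  then show ?case by (subst subformulas_d_step)
      (auto simp: data_of_form_simps syntax_d_defs binary_d_def subformulas_d_Leaf
        append_d_list[of _ "[]", simplified])
qed

section \<open>Discharging the antecedent of a node\<close>

primrec imps_d :: "data \<Rightarrow> data \<Rightarrow> data" where
  "imps_d Leaf F = F"
| "imps_d (Fork A x) F = imp_d A (imps_d x F)"

primrec curried_d :: "data \<Rightarrow> data \<Rightarrow> data" where
  "curried_d Leaf F = angled_d F"
| "curried_d (Fork A x) F = imp_d (angled_d A) (curried_d x F)"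

text \<open>
  The parameter collects the reversed antecedent, the succedent and the given proof. Dropping
  the processed suffix from the reversed antecedent leaves what is still to be discharged;
  the order is irrelevant, as antecedents are multisets.
\<close>

primrec discharge_d :: "data \<Rightarrow> data \<Rightarrow> data" where
  "discharge_d Leaf a = tail (tail a)"
| "discharge_d (Fork A x) a =
     node_d (drop_d (Fork A x) (head a)) (imps_d (Fork A x) (head (tail a))) (Fork (discharge_d x a) Leaf)"

lemma poly_time_imps_d: "poly_time2 imps_d"
  by (rule poly_time_list_context[where b = "\<lambda>a. a" and g = "\<lambda>x a u. imp_d (head x) u"])
    (auto simp: syntax_d_defs intro!: poly_time_intros)

lemma poly_time_curried_d: "poly_time2 curried_d"
  by (rule poly_time_list_context[where b = angled_d and g = "\<lambda>x a u. imp_d (angled_d (head x)) u"])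
    (auto simp: syntax_d_defs[abs_def] intro!: poly_time_intros)

lemma poly_time_discharge_d: "poly_time2 discharge_d"
proof (rule poly_time_list_context[where b = "\<lambda>a. tail (tail a)" and
      g = "\<lambda>x a u. node_d (drop_d x (head a)) (imps_d x (head (tail a))) (Fork u Leaf)"])
  show "poly_time (\<lambda>d. node_d (drop_d (head (head d)) (head (tail (head d))))
      (imps_d (head (head d)) (head (tail (tail (head d))))) (Fork (tail d) Leaf))"
    unfolding node_d_def
    by (intro poly_time_intros poly_time_comp2[OF poly_time_drop_d] poly_time_comp2[OF poly_time_imps_d])
qed (auto simp: node_d_def intro!: poly_time_intros)

fun imps :: "form list \<Rightarrow> form \<Rightarrow> form" where
  "imps [] F = F"
| "imps (A # As) F = Imp A (imps As F)"

lemma imps_d_form: "imps_d (data_of_list (map data_of_form As)) (data_of_form F) = data_of_form (imps As F)"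
  by (induction As) (auto simp: data_of_form_simps)

lemma curried_d_form:
  "curried_d (data_of_list (map data_of_form As)) (data_of_form F) = data_of_form_plus (curried As F)"
  by (induction As) (auto simp: data_of_form_plus_simps)

lemma std_subst_curried: "std_subst (curried As F) = imps As F"
  by (induction As) auto

text \<open>\<open>As\<close> are the formulas moved to the right by \<open>ImpR\<close>,
  \<open>Bs\<close> those still on the left; generalising over \<open>Bs\<close> lets the induction
  strip \<open>As\<close> from the front. In the reversed listing \<open>As\<close> comes first, so
  dropping \<open>length As\<close> entries leaves \<open>rev Bs\<close>.\<close>

lemma certifies_discharge:
  assumes "certifies C d (mset (Bs @ As), {#F#})"
  shows "certifies C (discharge_d (data_of_list (map data_of_form As))
      (Fork (data_of_list (map data_of_form (rev (Bs @ As)))) (Fork (data_of_form F) d)))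
    (mset Bs, {#imps As F#})"
  using assms
proof (induction As arbitrary: Bs)
  case Nil
  then show ?case by simp
next
  case (Cons A As)
  let ?a = "Fork (data_of_list (map data_of_form (rev (Bs @ A # As)))) (Fork (data_of_form F) d)"
  let ?d = "discharge_d (data_of_list (map data_of_form As)) ?a"
  have IH: "certifies C ?d (mset (A # Bs), {#imps As F#})"
    using Cons.IH[of "Bs @ [A]"] Cons.prems by simp
  have "LJ [(mset (A # Bs), {#imps As F#})] (mset (rev Bs), {#imps (A # As) F#})"
    using LJ.ImpR[of A "mset Bs" "imps As F"] by simp
  from certifies_LJ[OF this, of C "[?d]"] IH
  have "certifies C (node_d (data_of_list (map data_of_form (rev Bs)))
      (data_of_form (imps (A # As) F)) (Fork ?d Leaf)) (mset Bs, {#imps (A # As) F#})"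
    by simp
  moreover have "drop_d (data_of_list (map data_of_form (A # As))) (head ?a) =
      data_of_list (map data_of_form (rev Bs))"
    unfolding head.simps by (subst drop_d_list) (simp add: drop_map)
  moreover have "imps_d (data_of_list (map data_of_form (A # As))) (head (tail ?a)) =
      data_of_form (imps (A # As) F)"
    unfolding tail.simps head.simps by (rule imps_d_form)
  moreover have "discharge_d (data_of_list (map data_of_form (A # As))) ?a =
      node_d (drop_d (data_of_list (map data_of_form (A # As))) (head ?a))
        (imps_d (data_of_list (map data_of_form (A # As))) (head (tail ?a))) (Fork ?d Leaf)"
    unfolding list.map data_of_list.simps discharge_d.simps ..
  ultimately show ?case by simp
qed

text \<open>The given subproof \<open>d\<close> is reused as it stands: implication introductions
  below it yield the standard substitution of its curried Horn formula. An empty listing of the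
  succedent produces no items.\<close>

definition node_items_d :: "data \<Rightarrow> data" where
  "node_items_d d =
    (if tail (head d) = Leaf then Leaf
     else Fork (Fork (curried_d (head (head d)) (succedent_d d))
         (discharge_d (head (head d)) (Fork (rev_d (head (head d))) (Fork (succedent_d d) d))))
       (flatmap_d (\<lambda>X a. local_d X) (subformulas_d (succedent_d d)) Leaf))"

lemma poly_time_ignore: "poly_time f \<Longrightarrow> poly_time2 (\<lambda>x a. f x)"
  unfolding poly_time2_def by (rule poly_time_comp[of f head]) (auto intro: poly_time_intros)

lemma poly_time_node_items_d: "poly_time node_items_d"
  unfolding node_items_d_def succedent_d_def
  by (intro poly_time_intros poly_time_comp2[OF poly_time_curried_d]
      poly_time_comp2[OF poly_time_discharge_d] poly_time_comp[OF poly_time_rev_d]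
      poly_time_comp2[OF poly_time_flatmap_d[OF poly_time_ignore[OF poly_time_local_d]]]
      poly_time_comp[OF poly_time_subformulas_d])

lemma size_succedent:
  assumes "is_proof C \<pi>"
  shows "size (snd (concl \<pi>)) \<le> 1"
proof (cases \<pi>)
  case (Proof_Tree S \<pi>s)
  with assms have "CK_plus C (map concl \<pi>s) S" by simp
  then have "size (snd S) \<le> 1" by cases (auto elim!: CK.cases LJ.cases)
  with Proof_Tree show ?thesis by simp
qed

lemma node_items:
  assumes "represents_proof d \<pi>" "is_proof C \<pi>"
  obtains hs where "items C (node_items_d d) hs" "covers_sequent (set hs) (concl \<pi>)"
    "(\<Sum>F\<in>#snd (concl \<pi>). Suc (modal_depth F)) \<le> length hs"
proof -
  from assms(1) obtain d1 d2 ds \<Gamma> \<Delta> \<pi>s where d: "d = Fork (Fork d1 d2) (data_of_list ds)"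
    and \<pi>: "\<pi> = Proof_Tree (\<Gamma>, \<Delta>) \<pi>s" and \<Gamma>: "represents_mset data_of_form d1 \<Gamma>"
    and \<Delta>: "represents_mset data_of_form d2 \<Delta>"
    by cases
  obtain As where As: "\<Gamma> = mset As" "d1 = data_of_list (map data_of_form As)"
    using \<Gamma> unfolding represents_mset_def by blast
  obtain Fs where Fs: "\<Delta> = mset Fs" "d2 = data_of_list (map data_of_form Fs)"
    using \<Delta> unfolding represents_mset_def by blast
  from size_succedent[OF assms(2)] have "length Fs \<le> 1" by (simp add: \<pi> Fs)
  then consider "Fs = []" | F where "Fs = [F]" by (cases Fs) auto
  then show thesis
  proof cases
    case 1
    then show thesis
      by (intro that[of "[]"]) (simp_all add: node_items_d_def d \<pi> Fs items_Nil covers_sequent_def)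
  next
    case 2
    let ?hs = "curried As F # horn_of F"
    have cert: "certifies C d (mset ([] @ As), {#F#})"
      unfolding certifies_def proof_of_def using assms \<pi> As 2 Fs by auto
    have F: "succedent_d d = data_of_form F" by (simp add: succedent_d_def d Fs 2)
    have "item C (Fork (data_of_form_plus (curried As F))
        (discharge_d d1 (Fork (rev_d d1) (Fork (data_of_form F) d)))) (curried As F)"
      unfolding item_def std_subst_curried
      using certifies_discharge[OF cert] angled_horn_curried
      by (simp add: As rev_d_list rev_map)
    moreover have "items C (flatmap_d (\<lambda>X a. local_d X) (subformulas_d (data_of_form F)) Leaf) (horn_of F)"
      unfolding horn_of_def subformulas_d_form by (intro items_flatmap items_local)
    moreover have "tail (head d) \<noteq> Leaf" by (simp add: d Fs 2)
    ultimately have "items C (node_items_d d) ?hs"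
      unfolding node_items_d_def F by (simp add: d As curried_d_form items_Cons)
    moreover have "covers_sequent (set ?hs) (concl \<pi>)"
      using As by (auto simp: covers_sequent_def \<pi> Fs 2)
    \<comment> \<open>The curried formula accounts for the successor, and \<open>horn_of F\<close>
      for the modal depth.\<close>
    ultimately show thesis
      using modal_depth_le_horn[of F] by (intro that[of ?hs]) (auto simp: \<pi> Fs 2)
  qed
qed

section \<open>Collecting the nodes of a proof\<close>

definition subproofs_d :: "data \<Rightarrow> data" where
  "subproofs_d = collect_d head (\<lambda>x. tail (head x)) tail"

lemma dsize_head_tail: "x \<noteq> Leaf \<Longrightarrow> dsize (tail (head x)) + dsize (tail x) < dsize x"
proof -
  assume "x \<noteq> Leaf"
  then obtain d y where x: "x = Fork d y" by (cases x) auto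
  then show ?thesis using dsize_tail_le[of d] by simp
qed

lemma poly_time_subproofs_d: "poly_time subproofs_d"
  unfolding subproofs_d_def
  by (rule poly_time_collect_d[OF _ _ _ dsize_head_tail]) (auto intro!: poly_time_intros)

text \<open>A list of proof codes is a binary tree in the first-child, next-sibling sense: one child
  enters the premises of the first proof, the other moves on to the remaining proofs.\<close>

lemma subproofs_d_simps:
  "subproofs_d Leaf = Leaf"
  "subproofs_d (Fork d x) = Fork d (append_d (subproofs_d (tail d)) (subproofs_d x))"
  using dsize_head_tail[of "Fork d x"] unfolding subproofs_d_def
  by (simp_all add: collect_d.simps[of _ _ _ Leaf] collect_d.simps[of _ _ _ "Fork d x"])

definition proofs_items_d :: "data \<Rightarrow> data" where
  "proofs_items_d x = flatmap_d (\<lambda>d a. node_items_d d) (subproofs_d x) Leaf"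

lemma poly_time_proofs_items_d: "poly_time proofs_items_d"
  unfolding proofs_items_d_def
  by (intro poly_time_intros poly_time_comp[OF poly_time_subproofs_d]
      poly_time_comp2[OF poly_time_flatmap_d[OF poly_time_ignore[OF poly_time_node_items_d]]])

lemma append_d_Leaf: "append_d x Leaf = x"
  by (induction x) auto

lemma append_d_assoc: "append_d (append_d x y) z = append_d x (append_d y z)"
  by (induction x) auto

lemma flatmap_d_append: "flatmap_d g (append_d x y) a = append_d (flatmap_d g x a) (flatmap_d g y a)"
  by (induction x) (auto simp: append_d_assoc)

lemma proofs_items_d_simps:
  "proofs_items_d Leaf = Leaf"
  "proofs_items_d (Fork d x) =
    append_d (node_items_d d) (append_d (proofs_items_d (tail d)) (proofs_items_d x))"
  by (simp_all add: proofs_items_d_def subproofs_d_simps flatmap_d_append)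

lemma covers_sequent_mono: "covers_sequent H S \<Longrightarrow> H \<subseteq> H' \<Longrightarrow> covers_sequent H' S"
  unfolding covers_sequent_def by blast

lemma covers_mono: "covers H \<pi> \<Longrightarrow> H \<subseteq> H' \<Longrightarrow> covers H' \<pi>"
  by (induction H \<pi> rule: covers.induct) (auto intro: covers_sequent_mono)

text \<open>Items of different nodes are concatenated, so their number adds up over the nodes just
  as \<open>weight\<close> does, and \<open>covers\<close> survives the enlargement of the set. An
  inner induction runs over the list of premises.\<close>

lemma proof_items:
  assumes "represents_proof d \<pi>" "is_proof C \<pi>"
  shows "\<exists>hs. items C (append_d (node_items_d d) (proofs_items_d (tail d))) hs \<and>
    covers (set hs) \<pi> \<and> weight \<pi> \<le> length hs"
  using assms
proof (induction rule: represents_proof.induct)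
  case (1 d1 \<Gamma> d2 \<Delta> ds \<pi>s)
  let ?d = "Fork (Fork d1 d2) (data_of_list ds)" and ?\<pi> = "Proof_Tree (\<Gamma>, \<Delta>) \<pi>s"
  have "list_all2 represents_proof ds \<pi>s"
    using 1(3) by (rule list_all2_mono) blast
  with 1(1,2) have "represents_proof ?d ?\<pi>" by (rule represents_proof.intros)
  then obtain hs where hs: "items C (node_items_d ?d) hs" "covers_sequent (set hs) (\<Gamma>, \<Delta>)"
    "(\<Sum>F\<in>#\<Delta>. Suc (modal_depth F)) \<le> length hs"
    using node_items[OF _ 1(4)] by (metis snd_conv proof_tree.sel(1))
  have "\<forall>\<pi>\<in>set \<pi>s. is_proof C \<pi>" using 1(4) by simp
  with 1(3) have "\<exists>gs. items C (proofs_items_d (data_of_list ds)) gs \<and>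
      (\<forall>\<pi>\<in>set \<pi>s. covers (set gs) \<pi>) \<and> sum_list (map weight \<pi>s) \<le> length gs"
  proof (induction ds \<pi>s rule: list_all2_induct)
    case Nil
    show ?case by (auto simp: proofs_items_d_simps intro: items_Nil exI[of _ "[]"])
  next
    case (Cons d ds \<pi> \<pi>s)
    then obtain gs where gs: "items C (proofs_items_d (data_of_list ds)) gs"
      "\<forall>\<pi>\<in>set \<pi>s. covers (set gs) \<pi>" "sum_list (map weight \<pi>s) \<le> length gs"
      by auto
    from Cons obtain fs where fs: "items C (append_d (node_items_d d) (proofs_items_d (tail d))) fs"
      "covers (set fs) \<pi>" "weight \<pi> \<le> length fs"
      by auto
    have "items C (proofs_items_d (data_of_list (d # ds))) (fs @ gs)"
      using items_append[OF fs(1) gs(1)] by (simp add: proofs_items_d_simps append_d_assoc)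
    moreover have "\<forall>\<pi>'\<in>set (\<pi> # \<pi>s). covers (set (fs @ gs)) \<pi>'"
      using fs(2) gs(2) by (auto elim!: covers_mono)
    ultimately show ?case using fs(3) gs(3) by (intro exI[of _ "fs @ gs"]) auto
  qed
  then obtain gs where gs: "items C (proofs_items_d (data_of_list ds)) gs"
    "\<forall>\<pi>\<in>set \<pi>s. covers (set gs) \<pi>" "sum_list (map weight \<pi>s) \<le> length gs"
    by blast
  have "items C (append_d (node_items_d ?d) (proofs_items_d (tail ?d))) (hs @ gs)"
    using items_append[OF hs(1) gs(1)] by simp
  moreover have "covers (set (hs @ gs)) ?\<pi>"
    using hs(2) gs(2) by (auto elim!: covers_mono covers_sequent_mono)
  ultimately show ?case using hs(3) gs(3) by (intro exI[of _ "hs @ gs"]) auto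
qed

section \<open>Prefixing the items with boxes\<close>

primrec boxed_d :: "data \<Rightarrow> data \<Rightarrow> data" where
  "boxed_d Leaf A = A"
| "boxed_d (Fork e x) A = box_d (boxed_d x A)"

text \<open>\<open>K_Box\<close> with empty antecedent is necessitation; each box extends the proof
  by one node.\<close>

primrec necessitate_d :: "data \<Rightarrow> data \<Rightarrow> data" where
  "necessitate_d Leaf d = d"
| "necessitate_d (Fork e x) d =
     node_d Leaf (boxed_d (Fork e x) (succedent_d d)) (Fork (necessitate_d x d) Leaf)"

lemma poly_time_boxed_d: "poly_time2 boxed_d"
  by (rule poly_time_list_context[where b = "\<lambda>a. a" and g = "\<lambda>x a u. box_d u"])
    (auto simp: syntax_d_defs intro!: poly_time_intros)

lemma poly_time_necessitate_d: "poly_time2 necessitate_d"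
proof (rule poly_time_list_context[where b = "\<lambda>a. a" and
      g = "\<lambda>x a u. node_d Leaf (boxed_d x (succedent_d a)) (Fork u Leaf)"])
  show "poly_time (\<lambda>d. node_d Leaf (boxed_d (head (head d)) (succedent_d (tail (head d)))) (Fork (tail d) Leaf))"
    unfolding node_d_def succedent_d_def
    by (intro poly_time_intros poly_time_comp2[OF poly_time_boxed_d])
qed (auto simp: node_d_def intro!: poly_time_intros)

lemma boxed_d_form:
  "boxed_d (data_of_list xs) (data_of_form A) = data_of_form ((Box ^^ length xs) A)"
  by (induction xs) (auto simp: data_of_form_simps)

lemma boxed_d_form_plus:
  "boxed_d (data_of_list xs) (data_of_form_plus A) = data_of_form_plus ((Box ^^ length xs) A)"
  by (induction xs) (auto simp: data_of_form_plus_simps)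

lemma std_subst_boxes: "std_subst ((Box ^^ n) A) = (Box ^^ n) (std_subst A)"
  by (induction n) auto

lemma certifies_necessitate:
  assumes "certifies C d ({#}, {#A#})"
  shows "certifies C (necessitate_d (data_of_list xs) d) ({#}, {#(Box ^^ length xs) A#})"
proof (induction xs)
  case (Cons x xs)
  have "CK [({#}, {#(Box ^^ length xs) A#})] (mset [], {#(Box ^^ length (x # xs)) A#})"
    using CK.K_Box[of "{#}" "(Box ^^ length xs) A"] by simp
  from certifies_CK[OF this, of C "[necessitate_d (data_of_list xs) d]"] Cons
  show ?case
    unfolding boxed_d_form[symmetric] by (simp add: succedent_d_certified[OF assms])
qed (use assms in simp)

text \<open>\<open>L\<close> serves both as the list of items and, through its suffixes, as the
  supply of counters: every item is combined with every prefix of at most as many boxes as there are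
  items. The number of items therefore grows only quadratically.\<close>

definition boxes_d :: "data \<Rightarrow> data" where
  "boxes_d L = flatmap_d (\<lambda>e L. flatmap_d
     (\<lambda>x e. Fork (Fork (boxed_d x (head e)) (necessitate_d x (tail e))) Leaf) (suffixes_d L) e) L L"

lemma poly_time_boxes_d: "poly_time boxes_d"
proof -
  have 1: "poly_time2 (\<lambda>x e. Fork (Fork (boxed_d x (head e)) (necessitate_d x (tail e))) Leaf)"
    unfolding poly_time2_def
    by (intro poly_time_intros poly_time_comp2[OF poly_time_boxed_d]
        poly_time_comp2[OF poly_time_necessitate_d])
  have 2: "poly_time2 (\<lambda>e L. flatmap_d
      (\<lambda>x e. Fork (Fork (boxed_d x (head e)) (necessitate_d x (tail e))) Leaf) (suffixes_d L) e)"
    unfolding poly_time2_def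
    by (intro poly_time_intros poly_time_comp2[OF poly_time_flatmap_d[OF 1]]
        poly_time_comp[OF poly_time_suffixes_d])
  show ?thesis unfolding boxes_d_def
    by (intro poly_time_intros poly_time_comp2[OF poly_time_flatmap_d[OF 2]])
qed

lemma items_boxes:
  assumes "items C L hs"
  obtains ks where "items C (boxes_d L) ks" "set ks = boxes (length hs) (set hs)"
proof -
  from assms obtain es where es: "L = data_of_list es" "list_all2 (item C) es hs"
    unfolding items_def by blast
  let ?box = "\<lambda>x e. Fork (Fork (boxed_d x (head e)) (necessitate_d x (tail e))) Leaf"
  let ?k = "\<lambda>h. concat (map (\<lambda>xs. [(Box ^^ length xs) h]) (suffixes es))"
  have item: "item C (Fork (boxed_d (data_of_list xs) (head e)) (necessitate_d (data_of_list xs) (tail e)))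
      ((Box ^^ length xs) h)" if "item C e h" for e h and xs :: "data list"
    using that unfolding item_def
    by (auto simp: boxed_d_form_plus std_subst_boxes intro: certifies_necessitate angled_horn_boxes)
  have "items C (flatmap_d ?box (suffixes_d L) e) (?k h)" if "item C e h" for e h
    unfolding es(1) suffixes_d_list
    by (intro items_flatmap items_Cons items_Nil item that)
  then have "items C (flatmap_d (\<lambda>e L. flatmap_d ?box (suffixes_d L) e) (data_of_list es) L)
      (concat (map ?k hs))"
    by (rule items_flatmap_items[OF es(2)])
  then have "items C (boxes_d L) (concat (map ?k hs))"
    unfolding boxes_d_def using es(1) by simp
  moreover have "set (concat (map ?k hs)) = boxes (length hs) (set hs)"
  proof -
    have "set (?k h) = (\<lambda>i. (Box ^^ i) h) ` length ` set (suffixes es)" for h by auto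
    then have k: "set (?k h) = (\<lambda>i. (Box ^^ i) h) ` {..length hs}" for h
      using list_all2_lengthD[OF es(2)] by (simp only: length_suffixes)
    have "set (concat (map ?k hs)) = (\<Union>h\<in>set hs. set (?k h))" by auto
    also have "\<dots> = (\<Union>h\<in>set hs. (\<lambda>i. (Box ^^ i) h) ` {..length hs})" by (simp only: k)
    also have "\<dots> = boxes (length hs) (set hs)" unfolding boxes_def by auto
    finally show ?thesis .
  qed
  ultimately show thesis by (rule that)
qed

section \<open>The conjunction of all standard substitutions\<close>

primrec conjunction_d :: "data \<Rightarrow> data" where
  "conjunction_d Leaf = top_d"
| "conjunction_d (Fork e x) =
     (if x = Leaf then succedent_d (tail e) else and_d (succedent_d (tail e)) (conjunction_d x))"

primrec conjoin_d :: "data \<Rightarrow> data" where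
  "conjoin_d Leaf = node_d Leaf top_d Leaf"
| "conjoin_d (Fork e x) =
     (if x = Leaf then tail e
      else node_d Leaf (conjunction_d (Fork e x)) (Fork (tail e) (Fork (conjoin_d x) Leaf)))"

lemma poly_time_conjunction_d: "poly_time conjunction_d"
proof -
  have "poly_time2 (\<lambda>x a. conjunction_d x)"
    by (rule poly_time_list_context[where b = "\<lambda>a. top_d" and g = "\<lambda>x a u.
        if tail x = Leaf then succedent_d (tail (head x)) else and_d (succedent_d (tail (head x))) u"])
      (auto simp: syntax_d_defs intro!: poly_time_intros)
  from poly_time_comp2[OF this poly_time_id poly_time_id] show ?thesis .
qed

lemma poly_time_conjoin_d: "poly_time conjoin_d"
proof -
  have "poly_time2 (\<lambda>x a. conjoin_d x)"
  proof (rule poly_time_list_context[where b = "\<lambda>a. node_d Leaf top_d Leaf" and g = "\<lambda>x a u.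
      if tail x = Leaf then tail (head x)
      else node_d Leaf (conjunction_d x) (Fork (tail (head x)) (Fork u Leaf))"])
    show "poly_time (\<lambda>d. if tail (head (head d)) = Leaf then tail (head (head (head d)))
        else node_d Leaf (conjunction_d (head (head d)))
          (Fork (tail (head (head (head d)))) (Fork (tail d) Leaf)))"
      unfolding node_d_def
      by (intro poly_time_intros poly_time_comp[OF poly_time_conjunction_d])
  qed (auto simp: node_d_def intro!: poly_time_intros)
  from poly_time_comp2[OF this poly_time_id poly_time_id] show ?thesis .
qed

text \<open>The conjuncts are read off the succedents of the stored proofs, so the algorithm never
  computes a standard substitution. A last item is used without a further \<open>Top\<close>, in
  accordance with \<open>big_and\<close>.\<close>

lemma certifies_conjoin:
  assumes "items C d hs"
  shows "conjunction_d d = data_of_form (big_and (map std_subst hs)) \<and>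
    certifies C (conjoin_d d) ({#}, {#big_and (map std_subst hs)#})"
proof -
  from assms obtain es where d: "d = data_of_list es" and "list_all2 (item C) es hs"
    unfolding items_def by blast
  from this(2) show ?thesis unfolding d
  proof (induction es hs rule: list_all2_induct)
    case Nil
    show ?case using certifies_LJ[of "[]" "[]" Top C "[]"] by (simp add: LJ.TopR data_of_form_simps)
  next
    case (Cons e es h hs)
    then have cert: "certifies C (tail e) ({#}, {#std_subst h#})" unfolding item_def by auto
    note succ = succedent_d_certified[OF cert]
    show ?case
    proof (cases hs)
      case Nil
      with Cons cert succ show ?thesis by simp
    next
      case (Cons h' hs')
      let ?F = "big_and (map std_subst hs)"
      have ne: "data_of_list es \<noteq> Leaf" using Cons.hyps(2) Cons by (cases es) auto
      have big: "big_and (map std_subst (h # hs)) = And (std_subst h) ?F" using Cons by simp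
      have conj: "conjunction_d (data_of_list (e # es)) = data_of_form (And (std_subst h) ?F)"
        using ne succ Cons.IH by (simp add: data_of_form_simps)
      have "LJ [({#}, {#std_subst h#}), ({#}, {#?F#})] (mset [], {#And (std_subst h) ?F#})"
        using LJ.AndR by simp
      from certifies_LJ[OF this, of C "[tail e, conjoin_d (data_of_list es)]"] cert Cons.IH
      show ?thesis unfolding big conj[symmetric] using ne conj by simp
    qed
  qed
qed

text \<open>The given proof enters as a one-element list, the form expected by
  \<open>proofs_items_d\<close>. Of the final items, the heads form the multiset and the tails are
  combined into the proof.\<close>

definition horn_proof_d :: "data \<Rightarrow> data" where
  "horn_proof_d d = (\<lambda>S. Fork (flatmap_d (\<lambda>e a. Fork (head e) Leaf) S Leaf) (conjoin_d S))
     (boxes_d (proofs_items_d (Fork d Leaf)))"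

lemma poly_time_horn_proof_d: "poly_time horn_proof_d"
proof -
  have "poly_time2 (\<lambda>e a. Fork (head e) Leaf)"
    unfolding poly_time2_def by (intro poly_time_intros)
  then show ?thesis unfolding horn_proof_d_def
    by (intro poly_time_intros poly_time_comp2[OF poly_time_flatmap_d] poly_time_comp[OF poly_time_conjoin_d]
        poly_time_comp[OF poly_time_boxes_d] poly_time_comp[OF poly_time_proofs_items_d])
qed

lemma items_heads:
  assumes "items C d hs"
  shows "flatmap_d (\<lambda>e a. Fork (head e) Leaf) d a = data_of_list (map data_of_form_plus hs)"
proof -
  from assms obtain es where d: "d = data_of_list es" and "list_all2 (item C) es hs"
    unfolding items_def by blast
  from this(2) show ?thesis unfolding d
    by (induction es hs rule: list_all2_induct) (auto simp: item_def)
qed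

lemma items_angled_horn: "items C d hs \<Longrightarrow> h \<in> set hs \<Longrightarrow> angled_horn h"
  unfolding items_def item_def by (auto simp: list_all2_conv_all_nth in_set_conv_nth)

theorem theorem4p12:
  fixes C :: "form set"
  assumes "finite C" and "\<And>A. A \<in> C \<Longrightarrow> constructive A"
  shows "\<exists>(P :: program) (p :: nat poly).
    \<forall>(\<pi> :: nat proof_tree) (\<Omega> :: form multiset) (\<Lambda> :: form multiset) (d :: data).
      proof_of C \<pi> (\<Omega>, \<Lambda>) \<longrightarrow> represents_proof d \<pi> \<longrightarrow>
      (\<exists>(\<Sigma> :: form_plus multiset) (\<sigma> :: nat proof_tree) (out :: data) (c :: nat).
         run P d out c \<and> c \<le> poly p (dsize d) \<and> represents_output out \<Sigma> \<sigma> \<and>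
         derivable C (\<Sigma> + image_mset translate \<Omega>, image_mset translate \<Lambda>) \<and>
         (\<forall>A \<in># \<Sigma>. modal_horn A \<and> atoms A \<subseteq> range Angled) \<and>
         (\<exists>B. is_conjunction_of B (image_mset std_subst \<Sigma>) \<and> proof_of C \<sigma> ({#}, {#B#})))"
proof -
  obtain P p where P: "\<And>d. \<exists>c \<le> poly p (dsize d). run P d (horn_proof_d d) c"
    using poly_time_run[OF poly_time_horn_proof_d] by blast
  show ?thesis
  proof (intro exI[of _ P] exI[of _ p] allI impI)
    fix \<pi> :: "nat proof_tree" and \<Omega> \<Lambda> :: "form multiset" and d :: data
    assume "proof_of C \<pi> (\<Omega>, \<Lambda>)" and repr: "represents_proof d \<pi>"
    then have \<pi>: "is_proof C \<pi>" "concl \<pi> = (\<Omega>, \<Lambda>)" by (auto simp: proof_of_def)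
    obtain hs where hs: "items C (proofs_items_d (Fork d Leaf)) hs" "covers (set hs) \<pi>"
      "weight \<pi> \<le> length hs"
      using proof_items[OF repr \<pi>(1)]
      by (auto simp: proofs_items_d_simps append_d_Leaf)
    let ?S = "boxes_d (proofs_items_d (Fork d Leaf))"
    obtain ks where ks: "items C ?S ks" "set ks = boxes (length hs) (set hs)"
      using hs(1) by (rule items_boxes)
    obtain \<sigma> where \<sigma>: "represents_proof (conjoin_d ?S) \<sigma>"
      "proof_of C \<sigma> ({#}, {#big_and (map std_subst ks)#})"
      using certifies_conjoin[OF ks(1)] unfolding certifies_def by blast
    obtain c where c: "run P d (horn_proof_d d) c" "c \<le> poly p (dsize d)" using P by blast
    have "represents_output (horn_proof_d d) (mset ks) \<sigma>"
      unfolding represents_output_def horn_proof_d_def represents_mset_def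
      using items_heads[OF ks(1)] \<sigma>(1) by auto
    \<comment> \<open>The formulas in \<open>ks\<close> are, as a set, the prefixes of
      \<open>hs\<close> with up to \<open>length hs\<close> boxes. As this number bounds the weight
      of the given proof, the translation of that proof applies with \<open>n\<close> equal to
      it.\<close>
    moreover have "derivable C (mset ks + image_mset translate \<Omega>, image_mset translate \<Lambda>)"
      using entails_translate_proof[OF assms(2) \<pi>(1) hs(2,3)] \<pi>(2) ks(2)
      by (intro entails_derivable) (simp add: Un_commute)
    moreover have "\<forall>A \<in># mset ks. modal_horn A \<and> atoms A \<subseteq> range Angled"
      using items_angled_horn[OF ks(1)] by (simp add: angled_horn_def)
    moreover have "is_conjunction_of (big_and (map std_subst ks)) (image_mset std_subst (mset ks))"
      unfolding is_conjunction_of_def by (intro exI[of _ "map std_subst ks"]) simp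
    ultimately show "\<exists>\<Sigma> \<sigma> out c. run P d out c \<and> c \<le> poly p (dsize d) \<and>
        represents_output out \<Sigma> \<sigma> \<and>
        derivable C (\<Sigma> + image_mset translate \<Omega>, image_mset translate \<Lambda>) \<and>
        (\<forall>A \<in># \<Sigma>. modal_horn A \<and> atoms A \<subseteq> range Angled) \<and>
        (\<exists>B. is_conjunction_of B (image_mset std_subst \<Sigma>) \<and> proof_of C \<sigma> ({#}, {#B#}))"
      using c \<sigma>(2) by blast
  qed
qed

end
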